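(* Let $N\ge3$, $p>p_S$, and let $S>0$. For any sequence $\gamma_j\to\infty$, setting $u_j:=u(\cdot,\gamma_j)$, we have, as $j\to\infty$, $u_j\to u^*$, $u_j'\to(u^* )'$ and $u_j''\to(u^* )''$ uniformly on every compact subset of $(0,S]$.
   Context: $f(u):=-u+u^p$, $p_S:=\frac{N+2}{N-2}$, $\theta:=\frac{2}{p-1}$, $A:=\{\theta(N-2-\theta)\}^{1/(p-1)}$, $m:=\{\theta(N-2-\theta)\}^{-1/2}$, $\alpha:=m(N-2-2\theta)$. $u(s,\gamma)$ denotes the solution of $u''+\frac{N-1}{s}u'+f(u)=0$, $u(0)=\gamma$, $u'(0)=0$. $y^*$ is the unique solution on $\mathbb{R}$ of $y''+\alpha y'-y+y^p-m^2e^{2mt}y=0$ with $y(t)\to1$ as $t\to-\infty$, and $u^*(s):=As^{-\theta}y^*(m^{-1}\log s)$, $s>0$. (In the paper $S$ is taken to be the $(n+1)$-st positive critical point of $u^*$ for a fixed $n$.) *)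

theory Defs
  imports "HOL-Analysis.Analysis"
begin

definition spow :: "real \<Rightarrow> real \<Rightarrow> real" where
  "spow p u = \<bar>u\<bar> powr (p - 1) * u"

definition fnl :: "real \<Rightarrow> real \<Rightarrow> real" where
  "fnl p u = - u + spow p u"

definition pS :: "nat \<Rightarrow> real" where
  "pS N = (real N + 2) / (real N - 2)"

definition thetaC :: "real \<Rightarrow> real" where
  "thetaC p = 2 / (p - 1)"

definition AC :: "nat \<Rightarrow> real \<Rightarrow> real" where
  "AC N p = (thetaC p * (real N - 2 - thetaC p)) powr (1 / (p - 1))"

definition mC :: "nat \<Rightarrow> real \<Rightarrow> real" where
  "mC N p = (thetaC p * (real N - 2 - thetaC p)) powr (- 1 / 2)"

definition alphaC :: "nat \<Rightarrow> real \<Rightarrow> real" where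
  "alphaC N p = mC N p * (real N - 2 - 2 * thetaC p)"

definition radial_sol :: "nat \<Rightarrow> real \<Rightarrow> real \<Rightarrow> (real \<Rightarrow> real) \<Rightarrow> bool" where
  "radial_sol N p \<gamma> u \<longleftrightarrow>
     continuous_on {0..} u \<and> u 0 = \<gamma> \<and>
     (u has_real_derivative 0) (at 0 within {0..}) \<and>
     ((deriv u) \<longlongrightarrow> 0) (at_right 0) \<and>
     (\<forall>s>0. u differentiable (at s) \<and> deriv u differentiable (at s) \<and>
        deriv (deriv u) s + (real N - 1) / s * deriv u s + fnl p (u s) = 0)"

definition ystar_sol :: "nat \<Rightarrow> real \<Rightarrow> (real \<Rightarrow> real) \<Rightarrow> bool" where
  "ystar_sol N p y \<longleftrightarrow>
     (\<forall>t. y differentiable (at t) \<and> deriv y differentiable (at t) \<and>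
        deriv (deriv y) t + alphaC N p * deriv y t - y t + spow p (y t)
          - (mC N p)\<^sup>2 * exp (2 * mC N p * t) * y t = 0) \<and>
     (y \<longlongrightarrow> 1) at_bot"

definition ustar_of :: "nat \<Rightarrow> real \<Rightarrow> (real \<Rightarrow> real) \<Rightarrow> real \<Rightarrow> real" where
  "ustar_of N p y s = AC N p * s powr (- thetaC p) * y (ln s / mC N p)"

end

theory Submission
  imports Defs
begin

text \<open>In Emden--Fowler variables \<open>s = exp (m t)\<close>, \<open>u = A s powr (- \<theta>) y\<close>, every \<open>u\<^sub>j\<close> becomes a
  solution \<open>y\<^sub>j\<close> of the equation of \<open>y\<^sup>*\<close>, and supercriticality makes an energy nonincreasing.
  The energy of \<open>y\<^sub>j\<close> vanishes at \<open>-\<infinity>\<close> and has dropped below a fixed \<open>- c\<close> by a time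
  \<open>a\<^sub>j \<rightarrow> -\<infinity>\<close>; this keeps \<open>y\<^sub>j\<close> bounded and away from 0, and a strict Lyapunov function then forces
  \<open>y\<^sub>j\<close> close to the equilibrium 1 within a bounded time after \<open>a\<^sub>j\<close>. Near the equilibrium the
  difference \<open>y\<^sub>j - y\<^sup>*\<close> behaves like a damped oscillator and decays exponentially from a time near
  \<open>a\<^sub>j\<close> up to a time independent of \<open>j\<close>, so it tends to 0 there; continuous dependence
  carries this to every bounded interval.\<close>

subsection \<open>The signed power\<close>

text \<open>The obstacle is that every \<open>y\<^sub>j\<close> tends to 0 at
  \<open>-\<infinity>\<close> while \<open>y\<^sup>*\<close> tends to 1, so the two cannot be
  compared from there, and the time from \<open>a\<^sub>j\<close> to a fixed time is unbounded in
  \<open>j\<close>. Gronwall's inequality over that time gives no bound uniform in \<open>j\<close>;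
  a decay rate independent of \<open>j\<close> turns its length into an advantage. Hence the
  phase-plane lemmas fix all their constants before the solution is given. The autonomous limit
  equation has the equilibria 0, 1 and -1, and 0 is a saddle near which a trajectory could linger
  arbitrarily long. Energy below \<open>- c\<close> shuts out 0 and with it any sign change, and
  positivity at \<open>a\<^sub>j\<close> then rules out -1. The time \<open>a\<^sub>j\<close>
  belongs to a radius of order \<open>\<gamma>\<^sub>j powr (- (p - 1) / 2)\<close>, the natural
  length scale of \<open>u\<^sub>j\<close> near the origin; this scaling is why the energy lost by
  then is bounded below independently of \<open>j\<close>.\<close>

lemma abs_powr_tendsto_0:
  fixes q :: real
  assumes "q > 0"
  shows "((\<lambda>x::real. \<bar>x\<bar> powr q) \<longlongrightarrow> 0) (at 0)"
proof -
  have "((\<lambda>x::real. \<bar>x\<bar> powr q) \<longlongrightarrow> \<bar>0\<bar> powr q) (at 0)"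
    by (rule tendsto_powr2[OF tendsto_rabs[OF tendsto_ident_at]]) (use assms in auto)
  then show ?thesis using assms by simp
qed

text \<open>Makes the potential part of the energies differentiable whatever the sign of the
  solution. Both half-lines carry smooth powers; at 0 the difference quotient is at most
  \<open>\<bar>h\<bar> powr p\<close>.\<close>

lemma has_real_derivative_abs_powr:
  fixes p x :: real
  assumes "p > 1"
  shows "((\<lambda>x. \<bar>x\<bar> powr (p + 1)) has_real_derivative (p + 1) * spow p x) (at x)"
proof -
  consider "x > 0" | "x < 0" | "x = 0" by linarith
  then show ?thesis
  proof cases
    case 1
    have "((\<lambda>x. x powr (p + 1)) has_real_derivative (p + 1) * spow p x) (at x)"
      using 1 by (auto intro!: derivative_eq_intros simp: spow_def powr_diff)
    then show ?thesis
      by (rule has_field_derivative_transform_within_open[of _ _ _ "{0<..}"]) (use 1 in auto)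
  next
    case 2
    have "((\<lambda>x. (-x) powr (p + 1)) has_real_derivative (p + 1) * spow p x) (at x)"
      using 2 by (auto intro!: derivative_eq_intros simp: spow_def powr_diff)
    then show ?thesis
      by (rule has_field_derivative_transform_within_open[of _ _ _ "{..<0}"]) (use 2 in auto)
  next
    case 3
    have "((\<lambda>h::real. \<bar>h\<bar> powr (p + 1) / h) \<longlongrightarrow> 0) (at 0)"
    proof (rule Lim_null_comparison[OF _ abs_powr_tendsto_0[of p]])
      show "\<forall>\<^sub>F h::real in at 0. norm (\<bar>h\<bar> powr (p + 1) / h) \<le> \<bar>h\<bar> powr p"
        by (auto simp: eventually_at_filter powr_add)
    qed (use assms in auto)
    then show ?thesis using 3 by (simp add: DERIV_def spow_def)
  qed
qed

lemma has_real_derivative_spow: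
  fixes p x :: real
  assumes "p > 1"
  shows "(spow p has_real_derivative p * \<bar>x\<bar> powr (p - 1)) (at x)"
proof -
  consider "x > 0" | "x < 0" | "x = 0" by linarith
  then show ?thesis
  proof cases
    case 1
    have "((\<lambda>x. x powr (p - 1) * x) has_real_derivative
        ((p - 1) * x powr (p - 1 - 1)) * x + 1 * x powr (p - 1)) (at x)"
      by (rule DERIV_mult has_real_derivative_powr DERIV_ident 1)+
    then have "((\<lambda>x. x powr (p - 1) * x) has_real_derivative p * x powr (p - 1)) (at x)"
      by (rule DERIV_cong)
        (use 1 powr_add[of x "p - 1 - 1" 1] in \<open>simp add: mult.assoc powr_one algebra_simps\<close>)
    then have "((\<lambda>x. x powr (p - 1) * x) has_real_derivative p * \<bar>x\<bar> powr (p - 1)) (at x)"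
      using 1 by simp
    then show ?thesis
      by (rule has_field_derivative_transform_within_open[of _ _ _ "{0<..}"])
        (use 1 in \<open>auto simp: spow_def\<close>)
  next
    case 2
    have "((\<lambda>x. (-x) powr (p - 1) * x) has_real_derivative
        ((p - 1) * (-x) powr (p - 1 - 1) * -1) * x + 1 * (-x) powr (p - 1)) (at x)"
      by (intro DERIV_mult DERIV_ident DERIV_chain2[OF has_real_derivative_powr]
          DERIV_minus) (use 2 in auto)
    then have "((\<lambda>x. (-x) powr (p - 1) * x) has_real_derivative p * (-x) powr (p - 1)) (at x)"
      by (rule DERIV_cong)
        (use 2 powr_add[of "-x" "p - 1 - 1" 1] in \<open>simp add: mult.assoc powr_one algebra_simps\<close>)
    then have "((\<lambda>x. (-x) powr (p - 1) * x) has_real_derivative p * \<bar>x\<bar> powr (p - 1)) (at x)"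
      using 2 by simp
    then show ?thesis
      by (rule has_field_derivative_transform_within_open[of _ _ _ "{..<0}"])
        (use 2 in \<open>auto simp: spow_def\<close>)
  next
    case 3
    have "((\<lambda>h::real. \<bar>h\<bar> powr (p - 1)) \<longlongrightarrow> 0) (at 0)"
      using assms by (intro abs_powr_tendsto_0) auto
    then have "((\<lambda>h::real. \<bar>h\<bar> powr (p - 1) * h / h) \<longlongrightarrow> 0) (at 0)"
      by (rule Lim_transform_eventually) (auto simp: eventually_at_filter)
    then show ?thesis using 3 by (simp add: DERIV_def spow_def)
  qed
qed

lemma continuous_on_spow: "p > 1 \<Longrightarrow> continuous_on X (spow p)"
  by (meson DERIV_isCont continuous_at_imp_continuous_on has_real_derivative_spow)

text \<open>The closed range for \<open>z\<close> admits \<open>a = b\<close>, so two solutions can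
  be compared at every time without a case distinction.\<close>

lemma spow_mean_value:
  fixes p a b :: real
  assumes "p > 1"
  obtains z where "min a b \<le> z" "z \<le> max a b"
    "spow p a - spow p b = p * \<bar>z\<bar> powr (p - 1) * (a - b)"
proof -
  consider "a < b" | "b < a" | "a = b" by linarith
  then show ?thesis
  proof cases
    case 1
    from MVT2[OF 1, of "spow p" "\<lambda>x. p * \<bar>x\<bar> powr (p - 1)"] has_real_derivative_spow[OF assms]
    obtain z where "a < z" "z < b" "spow p b - spow p a = (b - a) * (p * \<bar>z\<bar> powr (p - 1))" by blast
    then show ?thesis by (intro that[of z]) (auto simp: algebra_simps)
  next
    case 2
    from MVT2[OF 2, of "spow p" "\<lambda>x. p * \<bar>x\<bar> powr (p - 1)"] has_real_derivative_spow[OF assms]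
    obtain z where "b < z" "z < a" "spow p a - spow p b = (a - b) * (p * \<bar>z\<bar> powr (p - 1))" by blast
    then show ?thesis by (intro that[of z]) (auto simp: algebra_simps)
  qed (auto intro: that[of a])
qed

lemma spow_lipschitz:
  fixes p B x y :: real
  assumes "p > 1" "\<bar>x\<bar> \<le> B" "\<bar>y\<bar> \<le> B"
  shows "\<bar>spow p x - spow p y\<bar> \<le> p * B powr (p - 1) * \<bar>x - y\<bar>"
proof -
  obtain z where z: "min x y \<le> z" "z \<le> max x y"
    "spow p x - spow p y = p * \<bar>z\<bar> powr (p - 1) * (x - y)"
    using spow_mean_value[OF assms(1), of x y] .
  have "\<bar>z\<bar> powr (p - 1) \<le> B powr (p - 1)"
    using z assms by (intro powr_mono2) auto
  then show ?thesis
    using z assms by (simp add: abs_mult mult_right_mono mult_left_mono)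
qed

text \<open>The normalisation \<open>T \<le> 0\<close> keeps all later choices in the range where
  \<open>exp (2 * m * t) \<le> 1\<close>.\<close>

lemma eventually_at_bot_obtain:
  fixes P :: "real \<Rightarrow> bool"
  assumes "\<forall>\<^sub>F t in at_bot. P t"
  obtains T where "T \<le> 0" "\<And>t. t \<le> T \<Longrightarrow> P t"
proof -
  obtain T where "\<And>t. t \<le> T \<Longrightarrow> P t" using assms by (auto simp: eventually_at_bot_linorder)
  then show ?thesis by (intro that[of "min T 0"]) auto
qed

subsection \<open>The Emden--Fowler equation and its energy\<close>

text \<open>A solution is recorded together with its derivative, as a trajectory of the first-order system.\<close>

locale emden_fowler =
  fixes \<alpha> m p :: real
  assumes \<alpha>: "\<alpha> > 0" and m: "m > 0" and p: "p > 1"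
begin

definition sol :: "(real \<Rightarrow> real) \<Rightarrow> (real \<Rightarrow> real) \<Rightarrow> bool" where
  "sol y v \<longleftrightarrow> (\<forall>t. (y has_real_derivative v t) (at t) \<and>
     (v has_real_derivative
        - \<alpha> * v t + (1 + m\<^sup>2 * exp (2 * m * t)) * y t - spow p (y t)) (at t))"

text \<open>The Hamiltonian of the undamped equation with its time-dependent coefficient frozen at
  \<open>t\<close>. Only the quadratic term in \<open>y t\<close> is negative, so a negative value
  forces \<open>y t \<noteq> 0\<close>.\<close>

definition energy :: "(real \<Rightarrow> real) \<Rightarrow> (real \<Rightarrow> real) \<Rightarrow> real \<Rightarrow> real" where
  "energy y v t = (v t)\<^sup>2 / 2 - (1 + m\<^sup>2 * exp (2 * m * t)) * (y t)\<^sup>2 / 2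
     + \<bar>y t\<bar> powr (p + 1) / (p + 1)"

lemma solD:
  assumes "sol y v"
  shows "(y has_real_derivative v t) (at t)"
    and "(v has_real_derivative
        - \<alpha> * v t + (1 + m\<^sup>2 * exp (2 * m * t)) * y t - spow p (y t)) (at t)"
  using assms unfolding sol_def by blast+

lemma sol_isCont:
  assumes "sol y v"
  shows "isCont y t" "isCont v t"
  using solD[OF assms, of t] by (auto intro: DERIV_isCont)

text \<open>The Hamiltonian part cancels along a solution. What remains is the damping and the
  explicit time derivative of the coefficient, and both have the same sign.\<close>

lemma energy_deriv:
  assumes "sol y v"
  shows "(energy y v has_real_derivative - \<alpha> * (v t)\<^sup>2 - m^3 * exp (2 * m * t) * (y t)\<^sup>2) (at t)"
proof -
  have "((\<lambda>t. \<bar>y t\<bar> powr (p + 1) / (p + 1)) has_real_derivative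
      ((p + 1) * spow p (y t) * v t) / (p + 1)) (at t)"
    by (intro DERIV_cdivide DERIV_chain2[OF has_real_derivative_abs_powr[OF p] solD(1)[OF assms]])
  then have 1: "((\<lambda>t. \<bar>y t\<bar> powr (p + 1) / (p + 1)) has_real_derivative spow p (y t) * v t) (at t)"
    using p by simp
  have "((\<lambda>t. (v t)\<^sup>2 / 2 - (1 + m\<^sup>2 * exp (2 * m * t)) * (y t)\<^sup>2 / 2
     + \<bar>y t\<bar> powr (p + 1) / (p + 1)) has_real_derivative
     - \<alpha> * (v t)\<^sup>2 - m^3 * exp (2 * m * t) * (y t)\<^sup>2) (at t)"
    apply (rule 1 solD[OF assms] derivative_eq_intros refl | simp)+
    using p by (simp add: field_simps power2_eq_square power3_eq_cube)
  then show ?thesis unfolding energy_def[abs_def] .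
qed

lemma energy_antimono:
  assumes "sol y v" "a \<le> b"
  shows "energy y v b \<le> energy y v a"
proof (rule DERIV_nonpos_imp_nonincreasing[OF assms(2)])
  fix x
  have "\<alpha> * (v x)\<^sup>2 \<ge> 0" "m^3 * exp (2 * m * x) * (y x)\<^sup>2 \<ge> 0"
    using \<alpha> m by auto
  then have "- \<alpha> * (v x)\<^sup>2 - m^3 * exp (2 * m * x) * (y x)\<^sup>2 \<le> 0"
    by linarith
  then show "\<exists>z. (energy y v has_real_derivative z) (at x) \<and> z \<le> 0"
    using energy_deriv[OF assms(1)] by blast
qed

text \<open>Since \<open>p + 1 > 2\<close>, the power dominates the quadratic term for large
  \<open>y\<close>: nonpositive energy gives
  \<open>\<bar>y t\<bar> powr (p - 1) \<le> (p + 1) / 2 * k\<close>, whose root is \<open>Y\<close>,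
  and then bounds \<open>v t\<close> by \<open>sqrt k * Y\<close>. The bound depends on
  \<open>T\<close> but not on the solution.\<close>

lemma energy_nonpos_bounded:
  obtains B where "B \<ge> 1"
    "\<And>y v t. sol y v \<Longrightarrow> energy y v t \<le> 0 \<Longrightarrow> t \<le> T \<Longrightarrow> \<bar>y t\<bar> \<le> B \<and> \<bar>v t\<bar> \<le> B"
proof -
  define k where "k = 1 + m\<^sup>2 * exp (2 * m * T)"
  define Y where "Y = ((p + 1) / 2 * k) powr (1 / (p - 1))"
  define B where "B = max 1 (max Y (sqrt k * Y))"
  have k: "k \<ge> 1" by (simp add: k_def)
  have Y: "Y \<ge> 0" by (simp add: Y_def)
  show ?thesis
  proof (rule that[of B])
    fix y v t assume *: "sol y v" "energy y v t \<le> 0" "t \<le> T"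
    define kt where "kt = 1 + m\<^sup>2 * exp (2 * m * t)"
    have kt: "kt \<le> k" "kt \<ge> 1" using *(3) m by (auto simp: k_def kt_def mult_left_mono)
    have E: "(v t)\<^sup>2 / 2 - kt * (y t)\<^sup>2 / 2 + \<bar>y t\<bar> powr (p + 1) / (p + 1) \<le> 0"
      using *(2) by (simp add: energy_def kt_def)
    have y: "\<bar>y t\<bar> \<le> Y"
    proof (cases "y t = 0")
      case False
      have "\<bar>y t\<bar> powr (p + 1) = \<bar>y t\<bar> powr ((p - 1) + 2)" by (simp add: add.commute)
      also have "\<dots> = \<bar>y t\<bar> powr (p - 1) * \<bar>y t\<bar> powr 2" by (rule powr_add)
      also have "\<bar>y t\<bar> powr 2 = (y t)\<^sup>2" using False by (simp add: powr_numeral)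
      finally have eq: "\<bar>y t\<bar> powr (p + 1) = \<bar>y t\<bar> powr (p - 1) * (y t)\<^sup>2" .
      have "\<bar>y t\<bar> powr (p + 1) / (p + 1) \<le> kt * (y t)\<^sup>2 / 2"
        using E zero_le_power2[of "v t"] by linarith
      then have "(\<bar>y t\<bar> powr (p - 1) / (p + 1)) * (y t)\<^sup>2 \<le> (kt / 2) * (y t)\<^sup>2" unfolding eq by simp
      then have "\<bar>y t\<bar> powr (p - 1) / (p + 1) \<le> kt / 2"
        by (rule mult_right_le_imp_le) (use False in simp)
      then have "\<bar>y t\<bar> powr (p - 1) \<le> (p + 1) / 2 * kt" using p by (simp add: field_simps)
      also have "\<dots> \<le> (p + 1) / 2 * k" using kt p by (simp add: mult_left_mono)
      finally have "(\<bar>y t\<bar> powr (p - 1)) powr (1 / (p - 1)) \<le> Y"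
        unfolding Y_def using p by (intro powr_mono2) auto
      then show ?thesis using p False by (simp add: powr_powr)
    qed (use Y in auto)
    have "(v t)\<^sup>2 / 2 \<le> kt * (y t)\<^sup>2 / 2"
      using E p powr_ge_zero[of "\<bar>y t\<bar>" "p + 1"]
      by (smt (verit) divide_nonneg_pos)
    also have "\<dots> \<le> k * Y\<^sup>2 / 2"
      using kt y by (intro divide_right_mono mult_mono) (auto simp: abs_le_square_iff[symmetric])
    finally have "(v t)\<^sup>2 \<le> (sqrt k * Y)\<^sup>2" using k by (simp add: power_mult_distrib)
    then have "\<bar>v t\<bar> \<le> \<bar>sqrt k * Y\<bar>" by (simp only: abs_le_square_iff)
    then have "\<bar>v t\<bar> \<le> sqrt k * Y" using k Y by simp
    with y show "\<bar>y t\<bar> \<le> B \<and> \<bar>v t\<bar> \<le> B" by (auto simp: B_def)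
  qed (simp add: B_def)
qed

lemma exp_small:
  fixes C e :: real
  assumes "e > 0"
  shows "\<forall>\<^sub>F t in at_bot. C * exp (2 * m * t) < e"
proof -
  have "((\<lambda>t. exp (2 * m * t)) \<longlongrightarrow> 0) at_bot"
    using m by (intro exp_at_bot[THEN filterlim_compose] filterlim_tendsto_pos_mult_at_bot[of _ "2*m"])
      (auto intro!: filterlim_ident)
  then have "((\<lambda>t. C * exp (2 * m * t)) \<longlongrightarrow> C * 0) at_bot" by (intro tendsto_intros)
  then show ?thesis using assms by (intro order_tendstoD(2)) auto
qed

end

subsection \<open>Lyapunov functions\<close>

text \<open>A bootstrap: the differential inequality is known only below the level
  \<open>\<omega>\<close>, but below it \<open>W\<close> cannot grow, so \<open>W\<close> never
  reaches the level and the inequality holds throughout. Gronwall's argument then gives the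
  decay.\<close>

lemma trapped_decay:
  fixes W W' :: "real \<Rightarrow> real"
  assumes der: "\<And>t. a \<le> t \<Longrightarrow> t \<le> b \<Longrightarrow> (W has_real_derivative W' t) (at t)"
    and nonneg: "\<And>t. a \<le> t \<Longrightarrow> t \<le> b \<Longrightarrow> W t \<ge> 0"
    and init: "W a < \<omega>" and c: "c \<ge> 0"
    and step: "\<And>t. a \<le> t \<Longrightarrow> t \<le> b \<Longrightarrow> W t \<le> \<omega> \<Longrightarrow> W' t \<le> - c * W t"
    and t: "a \<le> t" "t \<le> b"
  shows "W t < \<omega>" "W t \<le> W a * exp (- c * (t - a))"
proof -
  have cont: "continuous_on {a..b} W"
    by (intro continuous_at_imp_continuous_on ballI) (use der in \<open>auto intro: DERIV_isCont\<close>)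
  have below: "W x < \<omega>" if x: "a \<le> x" "x \<le> b" for x
  proof (rule ccontr)
    assume neg: "\<not> W x < \<omega>"
    define X where "X = {z \<in> {a..x}. \<omega> \<le> W z}"
    have "closed X" unfolding X_def
      using x by (intro continuous_on_closed_Collect_le continuous_on_const
        continuous_on_subset[OF cont]) auto
    moreover have "bounded X"
      by (rule bounded_subset[of "{a..x}"]) (auto simp: X_def)
    ultimately have "compact X" by (simp add: compact_eq_bounded_closed)
    moreover have "X \<noteq> {}" using neg x by (auto simp: X_def)
    ultimately obtain s where s: "s \<in> X" "\<And>z. z \<in> X \<Longrightarrow> s \<le> z"
      using compact_attains_inf[of X] by blast
    have sx: "s \<le> x" "\<omega> \<le> W s" using s(1) by (auto simp: X_def)
    have "a < s" using s(1) init by (cases "s = a") (auto simp: X_def)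
    \<comment> \<open>The mean value point lies before the first time \<open>s\<close> at which
      \<open>\<omega>\<close> is reached, so \<open>step\<close> applies there and contradicts the
      growth from \<open>W a\<close> to \<open>W s\<close>.\<close>
    then obtain z where z: "a < z" "z < s" "W s - W a = (s - a) * W' z"
      using MVT2[of a s W W'] der sx x by auto
    have zb: "a \<le> z" "z \<le> b" using z sx x by auto
    have "z \<notin> X" using s(2)[of z] z by auto
    then have "W z < \<omega>" using z sx x by (auto simp: X_def)
    then have "W' z \<le> - c * W z" using step zb by simp
    moreover have "c * W z \<ge> 0" using c nonneg[OF zb] by simp
    ultimately have "W' z \<le> 0" by simp
    then have "(s - a) * W' z \<le> 0" using \<open>a < s\<close> by (intro mult_nonneg_nonpos) auto
    with z sx init show False by linarith
  qed
  show "W t < \<omega>" using below t by blast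
  have "exp (c * t) * W t \<le> exp (c * a) * W a"
  proof (rule DERIV_nonpos_imp_nonincreasing[OF t(1), of "\<lambda>t. exp (c * t) * W t"])
    fix x assume x: "a \<le> x" "x \<le> t"
    then have "W' x \<le> - c * W x" using step[of x] below[of x] t by auto
    moreover have "((\<lambda>t. exp (c * t) * W t) has_real_derivative exp (c * x) * (c * W x + W' x)) (at x)"
      using x t by (auto intro!: derivative_eq_intros der simp: algebra_simps)
    moreover have "exp (c * x) * (c * W x + W' x) \<le> 0"
      using calculation(1) by (intro mult_nonneg_nonpos) auto
    ultimately show "\<exists>y. ((\<lambda>t. exp (c * t) * W t) has_real_derivative y) (at x) \<and> y \<le> 0" by blast
  qed
  then have "exp (- c * t) * (exp (c * t) * W t) \<le> exp (- c * t) * (exp (c * a) * W a)"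
    by (intro mult_left_mono) auto
  then have 1: "(exp (- c * t) * exp (c * t)) * W t \<le> (exp (- c * t) * exp (c * a)) * W a"
    by (simp only: mult.assoc)
  have 2: "exp (- c * t) * exp (c * t) = 1" by (simp flip: exp_add)
  have 3: "exp (- c * t) * exp (c * a) = exp (- c * (t - a))"
    unfolding exp_add[symmetric] by (simp add: right_diff_distrib)
  show "W t \<le> W a * exp (- c * (t - a))"
    using 1 unfolding 2 3 by (simp only: mult_1_left mult.commute)
qed

text \<open>The left-hand side is the derivative of \<open>energy - \<epsilon> v h(y)\<close>, where \<open>h y = y - y\<^sup>p\<close> vanishes only at
  the equilibria and \<open>z\<close> is the nonautonomous perturbation.\<close>

lemma strict_lyapunov_ineq:
  fixes \<alpha> \<epsilon> H P Z h h' v z :: real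
  assumes "\<epsilon> > 0" "\<epsilon> * (\<alpha>\<^sup>2 / 2 + H) \<le> \<alpha> / 2" "P \<ge> 0" "\<bar>z * h\<bar> \<le> Z" "\<bar>h'\<bar> \<le> H"
  shows "(- \<alpha> * v\<^sup>2 - P) - \<epsilon> * ((- \<alpha> * v + h + z) * h + h' * v * v)
    \<le> - (\<alpha> / 2) * v\<^sup>2 - (\<epsilon> / 2) * h\<^sup>2 + \<epsilon> * Z"
proof -
  \<comment> \<open>Young's inequality leaves half of \<open>h\<^sup>2\<close> as a gain; the rest
    is a multiple of \<open>v\<^sup>2\<close>, which the damping pays for when
    \<open>\<epsilon>\<close> is small.\<close>
  have "0 \<le> (\<alpha> * v - h)\<^sup>2" by simp
  then have "\<alpha> * v * h \<le> \<alpha>\<^sup>2 * v\<^sup>2 / 2 + h\<^sup>2 / 2" by (simp add: power2_eq_square algebra_simps)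
  moreover have "- (h' * v * v) \<le> H * v\<^sup>2"
    using mult_right_mono[of "- h'" H "v * v"] assms(5) by (simp add: power2_eq_square algebra_simps)
  ultimately have "- ((- \<alpha> * v + h + z) * h + h' * v * v)
      \<le> (\<alpha>\<^sup>2 / 2 + H) * v\<^sup>2 - h\<^sup>2 / 2 + Z"
    using assms(4) by (simp add: power2_eq_square algebra_simps)
  then have "\<epsilon> * - ((- \<alpha> * v + h + z) * h + h' * v * v)
      \<le> \<epsilon> * ((\<alpha>\<^sup>2 / 2 + H) * v\<^sup>2 - h\<^sup>2 / 2 + Z)"
    using assms(1) by (intro mult_left_mono) auto
  moreover have "(\<epsilon> * (\<alpha>\<^sup>2 / 2 + H)) * v\<^sup>2 \<le> (\<alpha> / 2) * v\<^sup>2"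
    using assms(2) by (intro mult_right_mono) auto
  ultimately show ?thesis using assms(3) by (simp add: algebra_simps)
qed

section \<open>Entry into a neighbourhood of the equilibrium within bounded time\<close>

context emden_fowler
begin

text \<open>Outside the \<open>\<eta>\<close>-neighbourhood of \<open>(1, 0)\<close> the function
  \<open>G\<close> falls at a rate of at least \<open>q / 2\<close>, yet
  \<open>\<bar>G\<bar> \<le> M\<close>, so no trajectory stays outside for time \<open>L\<close>.
  The energy alone does not suffice: its dissipation by damping vanishes where
  \<open>v t = 0\<close>.\<close>

lemma reaches_equilibrium:
  assumes c: "c > 0" and \<eta>: "\<eta> > 0"
  obtains L T0 where "L > 0" "T0 \<le> 0"
    "\<And>y v a. sol y v \<Longrightarrow> (\<And>t. energy y v t \<le> 0) \<Longrightarrow> energy y v a \<le> - c \<Longrightarrow> y a > 0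
      \<Longrightarrow> a + L \<le> T0 \<Longrightarrow> \<exists>t. a \<le> t \<and> t \<le> a + L \<and> \<bar>y t - 1\<bar> < \<eta> \<and> \<bar>v t\<bar> < \<eta>"
proof -
  obtain B where B: "B \<ge> 1"
    "\<And>y v t. sol y v \<Longrightarrow> energy y v t \<le> 0 \<Longrightarrow> t \<le> 0 \<Longrightarrow> \<bar>y t\<bar> \<le> B \<and> \<bar>v t\<bar> \<le> B"
    using energy_nonpos_bounded[of 0] by blast
  define k0 where "k0 = 1 + m\<^sup>2"
  \<comment> \<open>Energy at most \<open>- c\<close> gives
    \<open>c \<le> k0 * (y t)\<^sup>2 / 2\<close> for \<open>t \<le> 0\<close>, that is
    \<open>\<delta> \<le> \<bar>y t\<bar>\<close>.\<close>
  define \<delta> where "\<delta> = sqrt (2 * c / k0)"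
  define h where "h = (\<lambda>x. x - spow p x)"
  define H where "H = 1 + p * B powr (p - 1)"
  define Hb where "Hb = B + B powr (p - 1) * B"
  have k0: "k0 \<ge> 1" by (simp add: k0_def)
  have \<delta>: "\<delta> > 0" using c k0 by (simp add: \<delta>_def)
  have H: "H \<ge> 1" "\<And>x. \<bar>x\<bar> \<le> B \<Longrightarrow> \<bar>1 - p * \<bar>x\<bar> powr (p - 1)\<bar> \<le> H"
  proof -
    show "H \<ge> 1" using p by (simp add: H_def)
    fix x assume "\<bar>x\<bar> \<le> B"
    then have "p * \<bar>x\<bar> powr (p - 1) \<le> p * B powr (p - 1)" "0 \<le> p * \<bar>x\<bar> powr (p - 1)"
      using p by (auto intro!: mult_left_mono powr_mono2)
    then show "\<bar>1 - p * \<bar>x\<bar> powr (p - 1)\<bar> \<le> H" by (auto simp: H_def)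
  qed
  have Hb: "\<bar>h x\<bar> \<le> Hb" if "\<bar>x\<bar> \<le> B" for x
  proof -
    have "\<bar>x\<bar> powr (p - 1) * \<bar>x\<bar> \<le> B powr (p - 1) * B"
      using p that by (intro mult_mono powr_mono2) auto
    then show ?thesis using that by (auto simp: h_def Hb_def spow_def abs_mult intro!: order_trans[OF abs_triangle_ineq4])
  qed
  have Hb0: "Hb \<ge> 1" using B by (simp add: Hb_def add_increasing2)
  have hder: "(h has_real_derivative 1 - p * \<bar>x\<bar> powr (p - 1)) (at x)" for x
    unfolding h_def by (intro derivative_intros has_real_derivative_spow p)
  have hcont: "continuous_on X h" for X
    unfolding h_def by (intro continuous_intros continuous_on_spow p)
  \<comment> \<open>\<open>h\<close> vanishes only at 0, 1 and -1, all excluded from this compact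
    set, so \<open>\<bar>h\<bar>\<close> has a positive minimum there; if the set is empty, any
    positive number serves.\<close>
  obtain h0 where h0: "h0 > 0" "\<And>x. \<delta> \<le> x \<Longrightarrow> x \<le> B \<Longrightarrow> \<bar>x - 1\<bar> \<ge> \<eta> \<Longrightarrow> \<bar>h x\<bar> \<ge> h0"
  proof -
    define X where "X = {x \<in> {\<delta>..B}. \<eta> \<le> \<bar>x - 1\<bar>}"
    have "closed X" unfolding X_def by (intro continuous_on_closed_Collect_le continuous_intros closed_atLeastAtMost)
    moreover have "bounded X"
      by (rule bounded_subset[of "{\<delta>..B}"]) (auto simp: X_def)
    ultimately have X: "compact X" by (simp add: compact_eq_bounded_closed)
    show ?thesis
    proof (cases "X = {}")
      case True
      then show ?thesis by (intro that[of 1]) (auto simp: X_def)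
    next
      case False
      obtain x0 where x0: "x0 \<in> X" "\<And>x. x \<in> X \<Longrightarrow> \<bar>h x0\<bar> \<le> \<bar>h x\<bar>"
        using continuous_attains_inf[OF X False, of "\<lambda>x. \<bar>h x\<bar>"] hcont by (blast intro: continuous_on_rabs)
      have "x0 > 0" "x0 \<noteq> 1" using x0(1) \<delta> \<eta> by (auto simp: X_def)
      then have "h x0 \<noteq> 0" using p by (auto simp: h_def spow_def powr_eq_one_iff_gen)
      then show ?thesis using x0 by (intro that[of "\<bar>h x0\<bar>"]) (auto simp: X_def)
    qed
  qed
  \<comment> \<open>Chosen so that the smallness condition of \<open>strict_lyapunov_ineq\<close>
    holds with equality.\<close>
  define \<epsilon> where "\<epsilon> = \<alpha> / 2 / (\<alpha>\<^sup>2 / 2 + H)"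
  have den: "\<alpha>\<^sup>2 / 2 + H > 0" using H(1) by (simp add: add_nonneg_pos)
  have \<epsilon>: "\<epsilon> > 0" "\<epsilon> * (\<alpha>\<^sup>2 / 2 + H) \<le> \<alpha> / 2"
  proof -
    show "\<epsilon> > 0" unfolding \<epsilon>_def using \<alpha> den by (intro divide_pos_pos) auto
    have "\<epsilon> * (\<alpha>\<^sup>2 / 2 + H) = \<alpha> / 2"
      unfolding \<epsilon>_def using den less_imp_neq[OF den] by (subst times_divide_eq_left, subst nonzero_mult_div_cancel_right) auto
    then show "\<epsilon> * (\<alpha>\<^sup>2 / 2 + H) \<le> \<alpha> / 2" by simp
  qed
  \<comment> \<open>Far from \<open>(1, 0)\<close> either
    \<open>\<bar>v t\<bar> \<ge> \<eta>\<close> or \<open>\<bar>h (y t)\<bar> \<ge> h0\<close>;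
    \<open>q\<close> is the smaller of the two resulting dissipation rates.\<close>
  define q where "q = min ((\<alpha> / 2) * \<eta>\<^sup>2) ((\<epsilon> / 2) * h0\<^sup>2)"
  have q: "q > 0" using \<alpha> \<eta> \<epsilon> h0 by (simp add: q_def)
  \<comment> \<open>Before \<open>T0\<close> the nonautonomous perturbation consumes less than half
    of the rate \<open>q\<close>.\<close>
  obtain T0 where T0: "T0 \<le> 0" "\<And>t. t \<le> T0 \<Longrightarrow> (\<epsilon> * (m\<^sup>2 * B * Hb)) * exp (2 * m * t) < q / 2"
    using eventually_at_bot_obtain[OF exp_small[of "q / 2" "\<epsilon> * (m\<^sup>2 * B * Hb)"]] q by auto
  define M where "M = k0 * B\<^sup>2 / 2 + \<epsilon> * (B * Hb)"
  have M: "M \<ge> 0" using k0 B Hb0 \<epsilon> by (simp add: M_def)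
  \<comment> \<open>A fall at rate \<open>q / 2\<close> over time \<open>L\<close> amounts to
    \<open>2 * M + q / 2\<close>, more than the range \<open>[-M, M]\<close> of \<open>G\<close>
    allows.\<close>
  define L where "L = 4 * M / q + 1"
  have "L > 0" using M q by (simp add: L_def add_nonneg_pos)
  show ?thesis
  proof (rule that[OF \<open>L > 0\<close> T0(1)])
    fix y v a
    assume sol: "sol y v" and neg: "\<And>t. energy y v t \<le> 0" and Ea: "energy y v a \<le> - c"
      and ya: "y a > 0" and aL: "a + L \<le> T0"
    show "\<exists>t. a \<le> t \<and> t \<le> a + L \<and> \<bar>y t - 1\<bar> < \<eta> \<and> \<bar>v t\<bar> < \<eta>"
    proof (rule ccontr)
      assume far: "\<not> ?thesis"
      have kt: "1 + m\<^sup>2 * exp (2 * m * t) \<le> k0" if "t \<le> 0" for t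
        using that m by (auto simp: k0_def mult_nonneg_nonpos intro: mult_left_le)
      have bd: "\<bar>y t\<bar> \<le> B" "\<bar>v t\<bar> \<le> B" if "t \<le> 0" for t using B(2)[OF sol neg that] by auto
      have ylow: "\<delta> \<le> \<bar>y t\<bar>" if "a \<le> t" "t \<le> 0" for t
      proof -
        have "energy y v t \<le> - c" using energy_antimono[OF sol that(1)] Ea by simp
        moreover have "\<bar>y t\<bar> powr (p + 1) / (p + 1) \<ge> 0" "(v t)\<^sup>2 \<ge> 0" using p by auto
        ultimately have "c \<le> (1 + m\<^sup>2 * exp (2 * m * t)) * (y t)\<^sup>2 / 2" unfolding energy_def by linarith
        also have "\<dots> \<le> k0 * (y t)\<^sup>2 / 2" using kt[OF that(2)] by (intro divide_right_mono mult_right_mono) auto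
        finally have "2 * c / k0 \<le> (y t)\<^sup>2" using k0 by (simp add: field_simps)
        then have "sqrt (2 * c / k0) \<le> sqrt ((y t)\<^sup>2)" by (rule real_sqrt_le_mono)
        then show ?thesis by (simp add: \<delta>_def)
      qed
      \<comment> \<open>A sign change would pass through 0, which \<open>ylow\<close> forbids; this
        confines the trajectory to the side of the equilibrium 1.\<close>
      have ypos: "\<delta> \<le> y t" if "a \<le> t" "t \<le> 0" for t
      proof (rule ccontr)
        assume "\<not> ?thesis"
        with ylow[OF that] have "y t < 0" using \<delta> by auto
        then have "\<exists>s\<ge>a. s \<le> t \<and> y s = 0"
          using ya that sol_isCont(1)[OF sol] by (intro IVT2) auto
        then obtain s where "a \<le> s" "s \<le> t" "y s = 0" by blast
        with ylow[of s] \<delta> that show False by auto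
      qed
      define G where "G = (\<lambda>t. energy y v t - \<epsilon> * (v t * h (y t)))"
      define G' where "G' = (\<lambda>t. (- \<alpha> * (v t)\<^sup>2 - m^3 * exp (2 * m * t) * (y t)\<^sup>2)
        - \<epsilon> * ((- \<alpha> * v t + h (y t) + m\<^sup>2 * exp (2 * m * t) * y t) * h (y t)
            + (1 - p * \<bar>y t\<bar> powr (p - 1)) * v t * v t))"
      have Gder: "(G has_real_derivative G' t) (at t)" for t
      proof -
        have hy: "((\<lambda>t. h (y t)) has_real_derivative (1 - p * \<bar>y t\<bar> powr (p - 1)) * v t) (at t)"
          by (rule DERIV_chain2[OF hder solD(1)[OF sol]])
        have "(G has_real_derivative (- \<alpha> * (v t)\<^sup>2 - m^3 * exp (2 * m * t) * (y t)\<^sup>2)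
          - \<epsilon> * ((- \<alpha> * v t + (1 + m\<^sup>2 * exp (2 * m * t)) * y t - spow p (y t)) * h (y t)
            + (1 - p * \<bar>y t\<bar> powr (p - 1)) * v t * v t)) (at t)"
          unfolding G_def
          by (intro DERIV_diff DERIV_cmult DERIV_mult energy_deriv sol solD(2) hy)
        then show ?thesis by (rule DERIV_cong) (simp add: G'_def h_def algebra_simps)
      qed
      have Gneg: "G' t \<le> - (q / 2)" if t: "a \<le> t" "t \<le> a + L" for t
      proof -
        have t0: "t \<le> T0" "t \<le> 0" using t aL T0(1) by auto
        have z: "\<bar>m\<^sup>2 * exp (2 * m * t) * y t * h (y t)\<bar> \<le> m\<^sup>2 * exp (2 * m * t) * (B * Hb)"
          using bd[OF t0(2)] Hb[of "y t"] B
          by (auto simp: abs_mult mult.assoc intro!: mult_left_mono mult_mono)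
        have "G' t \<le> - (\<alpha> / 2) * (v t)\<^sup>2 - (\<epsilon> / 2) * (h (y t))\<^sup>2 + \<epsilon> * (m\<^sup>2 * exp (2 * m * t) * (B * Hb))"
          unfolding G'_def
          by (rule strict_lyapunov_ineq[OF \<epsilon> _ z H(2)]) (use m bd[OF t0(2)] in auto)
        also have "\<epsilon> * (m\<^sup>2 * exp (2 * m * t) * (B * Hb)) = (\<epsilon> * (m\<^sup>2 * B * Hb)) * exp (2 * m * t)"
          by (simp add: algebra_simps)
        also have "\<dots> < q / 2" by (rule T0(2)[OF t0(1)])
        finally have *: "G' t \<le> - (\<alpha> / 2) * (v t)\<^sup>2 - (\<epsilon> / 2) * (h (y t))\<^sup>2 + q / 2" by simp
        have "q \<le> (\<alpha> / 2) * (v t)\<^sup>2 + (\<epsilon> / 2) * (h (y t))\<^sup>2"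
        proof (cases "\<bar>v t\<bar> < \<eta>")
          case True
          then have "\<bar>y t - 1\<bar> \<ge> \<eta>" using far t by force
          then have "h0 \<le> \<bar>h (y t)\<bar>" using h0(2)[of "y t"] ypos[of t] bd[of t] t t0 by auto
          then have "h0\<^sup>2 \<le> \<bar>h (y t)\<bar>\<^sup>2" using h0(1) by (intro power_mono) auto
          then have "h0\<^sup>2 \<le> (h (y t))\<^sup>2" by simp
          then have "(\<epsilon> / 2) * h0\<^sup>2 \<le> (\<epsilon> / 2) * (h (y t))\<^sup>2" using \<epsilon> by (intro mult_left_mono) auto
          moreover have "(\<alpha> / 2) * (v t)\<^sup>2 \<ge> 0" using \<alpha> by simp
          ultimately show ?thesis by (simp add: q_def)
        next
          case False
          then have "\<eta>\<^sup>2 \<le> \<bar>v t\<bar>\<^sup>2" using \<eta> by (intro power_mono) auto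
          then have "\<eta>\<^sup>2 \<le> (v t)\<^sup>2" by simp
          then have "(\<alpha> / 2) * \<eta>\<^sup>2 \<le> (\<alpha> / 2) * (v t)\<^sup>2" using \<alpha> by (intro mult_left_mono) auto
          moreover have "(\<epsilon> / 2) * (h (y t))\<^sup>2 \<ge> 0" using \<epsilon> by simp
          ultimately show ?thesis by (simp add: q_def)
        qed
        with * show ?thesis by simp
      qed
      have Gbd: "\<bar>G t\<bar> \<le> M" if "t \<le> 0" for t
      proof -
        have "(1 + m\<^sup>2 * exp (2 * m * t)) * (y t)\<^sup>2 \<le> k0 * B\<^sup>2"
          using kt[OF that] bd[OF that] k0 B(1)
          by (intro mult_mono) (auto simp: abs_le_square_iff[symmetric])
        moreover have "\<bar>y t\<bar> powr (p + 1) / (p + 1) \<ge> 0" "(v t)\<^sup>2 \<ge> 0" using p by auto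
        ultimately have "- (k0 * B\<^sup>2 / 2) \<le> energy y v t" unfolding energy_def by linarith
        moreover have "\<bar>v t * h (y t)\<bar> \<le> B * Hb"
          using bd[OF that] Hb[of "y t"] B by (auto simp: abs_mult intro!: mult_mono)
        then have "\<bar>\<epsilon> * (v t * h (y t))\<bar> \<le> \<epsilon> * (B * Hb)" using \<epsilon> by (simp add: abs_mult)
        ultimately show ?thesis using neg[of t] k0 by (auto simp: G_def M_def abs_le_iff)
      qed
      obtain z where z: "a < z" "z < a + L" "G (a + L) - G a = L * G' z"
        using MVT2[of a "a + L" G G'] Gder \<open>L > 0\<close> by auto
      have "L * G' z \<le> L * (- (q / 2))" using Gneg[of z] z \<open>L > 0\<close> by (intro mult_left_mono) auto
      moreover have "L * (q / 2) = 2 * M + q / 2" using q by (simp add: L_def field_simps)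
      moreover have "\<bar>G (a + L)\<bar> \<le> M" "\<bar>G a\<bar> \<le> M"
        using Gbd aL T0(1) \<open>L > 0\<close> by auto
      ultimately show False using z(3) q by linarith
    qed
  qed
qed

end

section \<open>Exponential decay of differences near the equilibrium\<close>

lemma quadratic_form_bounds:
  fixes \<beta> \<kappa> x z :: real
  assumes "\<beta> > 0" "\<kappa>\<^sup>2 \<le> \<beta> / 4"
  shows "z\<^sup>2 / 4 + \<beta> / 4 * x\<^sup>2 \<le> z\<^sup>2 / 2 + \<beta> * x\<^sup>2 / 2 + \<kappa> * x * z"
    and "z\<^sup>2 / 2 + \<beta> * x\<^sup>2 / 2 + \<kappa> * x * z \<le> 3 / 4 * (z\<^sup>2 + \<beta> * x\<^sup>2)"
proof -
  \<comment> \<open>Both squares together bound the cross term by half of the diagonal part, which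
    gives the factors 1/2 and 3/2 relative to it.\<close>
  have "0 \<le> (z / 2 + \<kappa> * x)\<^sup>2" "0 \<le> (z / 2 - \<kappa> * x)\<^sup>2" by auto
  then have "\<bar>\<kappa> * x * z\<bar> \<le> z\<^sup>2 / 4 + \<kappa>\<^sup>2 * x\<^sup>2"
    by (simp add: power2_eq_square algebra_simps abs_le_iff)
  moreover have "\<kappa>\<^sup>2 * x\<^sup>2 \<le> \<beta> / 4 * x\<^sup>2" using assms by (intro mult_right_mono) auto
  ultimately have "\<bar>\<kappa> * x * z\<bar> \<le> z\<^sup>2 / 4 + \<beta> / 4 * x\<^sup>2" by simp
  then show "z\<^sup>2 / 4 + \<beta> / 4 * x\<^sup>2 \<le> z\<^sup>2 / 2 + \<beta> * x\<^sup>2 / 2 + \<kappa> * x * z"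
    "z\<^sup>2 / 2 + \<beta> * x\<^sup>2 / 2 + \<kappa> * x * z \<le> 3 / 4 * (z\<^sup>2 + \<beta> * x\<^sup>2)"
    by (simp_all add: algebra_simps abs_le_iff)
qed

text \<open>The left-hand side is the derivative of \<open>z\<^sup>2/2 + \<beta> x\<^sup>2/2 + \<kappa> x z\<close> along
  \<open>x' = z\<close>, \<open>z' = - \<alpha> z - (\<beta> + r) x\<close>; the cross term makes the decay strict in \<open>x\<close> as well.\<close>

lemma damped_oscillator_ineq:
  fixes \<alpha> \<beta> \<kappa> d r x z :: real
  assumes "\<alpha> > 0" "\<beta> > 0" "\<kappa> > 0" "\<kappa> \<le> \<alpha> / 4" "\<kappa> * \<alpha> \<le> \<beta> / 4"
    "d \<le> \<alpha> / 2" "d \<le> \<beta> / 4" "d \<le> \<kappa> * \<beta> / 2" "\<bar>r\<bar> \<le> d"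
  shows "z * (- \<alpha> * z - (\<beta> + r) * x) + \<beta> * x * z + \<kappa> * (z * z + x * (- \<alpha> * z - (\<beta> + r) * x))
    \<le> - (\<kappa> / 4) * (z\<^sup>2 + \<beta> * x\<^sup>2)"
proof -
  have sq: "z\<^sup>2 \<ge> 0" "x\<^sup>2 \<ge> 0" by auto
  \<comment> \<open>A budget of quarters: the errors \<open>1\<close>, \<open>2\<close>,
    \<open>4\<close> each cost \<open>\<alpha> / 4 * z\<^sup>2\<close>, the errors \<open>1\<close>,
    \<open>2\<close>, \<open>3\<close> each cost \<open>\<kappa> * \<beta> / 4 * x\<^sup>2\<close>,
    and one quarter of each good term survives.\<close>
  have "0 \<le> (z / 2 + \<kappa> * x)\<^sup>2" by simp
  then have "- (\<kappa> * x * z) \<le> z\<^sup>2 / 4 + \<kappa>\<^sup>2 * x\<^sup>2"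
    by (simp add: power2_eq_square algebra_simps)
  then have "\<alpha> * - (\<kappa> * x * z) \<le> \<alpha> * (z\<^sup>2 / 4 + \<kappa>\<^sup>2 * x\<^sup>2)"
    using assms(1) by (intro mult_left_mono) auto
  moreover have "(\<kappa> * \<alpha>) * (\<kappa> * x\<^sup>2) \<le> \<beta> / 4 * (\<kappa> * x\<^sup>2)"
    using assms by (intro mult_right_mono) auto
  ultimately have 1: "- (\<kappa> * \<alpha> * (x * z)) \<le> \<alpha> / 4 * z\<^sup>2 + \<kappa> * \<beta> / 4 * x\<^sup>2"
    by (simp add: power2_eq_square algebra_simps)
  have "0 \<le> (\<bar>x\<bar> - \<bar>z\<bar>)\<^sup>2" by simp
  then have "\<bar>x * z\<bar> \<le> (z\<^sup>2 + x\<^sup>2) / 2" by (simp add: power2_diff abs_mult)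
  then have "\<bar>r\<bar> * \<bar>x * z\<bar> \<le> d * ((z\<^sup>2 + x\<^sup>2) / 2)"
    using assms by (intro mult_mono) auto
  then have "- (r * (x * z)) \<le> d * ((z\<^sup>2 + x\<^sup>2) / 2)"
    by (simp flip: abs_mult add: abs_le_iff)
  moreover have "d * z\<^sup>2 \<le> \<alpha> / 2 * z\<^sup>2" "d * x\<^sup>2 \<le> \<kappa> * \<beta> / 2 * x\<^sup>2"
    using assms sq by (intro mult_right_mono; simp)+
  ultimately have 2: "- (r * (x * z)) \<le> \<alpha> / 4 * z\<^sup>2 + \<kappa> * \<beta> / 4 * x\<^sup>2" by (simp add: algebra_simps)
  have "- r * (\<kappa> * x\<^sup>2) \<le> \<beta> / 4 * (\<kappa> * x\<^sup>2)"
    using assms by (intro mult_right_mono) auto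
  then have 3: "- (\<kappa> * r * x\<^sup>2) \<le> \<kappa> * \<beta> / 4 * x\<^sup>2" by (simp add: algebra_simps)
  have 4: "\<kappa> * z\<^sup>2 \<le> \<alpha> / 4 * z\<^sup>2" using assms sq by (intro mult_right_mono) auto
  have "z * (- \<alpha> * z - (\<beta> + r) * x) + \<beta> * x * z + \<kappa> * (z * z + x * (- \<alpha> * z - (\<beta> + r) * x))
    = - \<alpha> * z\<^sup>2 - r * (x * z) + \<kappa> * z\<^sup>2 - \<kappa> * \<alpha> * (x * z) - \<kappa> * \<beta> * x\<^sup>2 - \<kappa> * r * x\<^sup>2"
    by (simp add: power2_eq_square algebra_simps)
  also have "\<dots> \<le> - (\<alpha> / 4) * z\<^sup>2 - \<kappa> * \<beta> / 4 * x\<^sup>2" using 1 2 3 4 by (simp add: algebra_simps)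
  also have "\<dots> \<le> - (\<kappa> / 4) * (z\<^sup>2 + \<beta> * x\<^sup>2)"
    using 4 mult_nonneg_nonneg[OF less_imp_le[OF assms(3)] sq(1)] by (simp add: algebra_simps)
  finally show ?thesis .
qed

context emden_fowler
begin

text \<open>Writing the error as a factor \<open>r\<close> of \<open>a - b\<close>, not as an
  additive remainder, makes the difference of two solutions solve an exactly linear oscillator
  equation with a perturbed coefficient.\<close>

lemma spow_linearization_at_1:
  assumes "d > 0"
  obtains \<epsilon> where "\<epsilon> > 0"
    "\<And>a b. \<bar>a - 1\<bar> < \<epsilon> \<Longrightarrow> \<bar>b - 1\<bar> < \<epsilon> \<Longrightarrow> \<exists>r. \<bar>r\<bar> \<le> d \<and> spow p a - spow p b = (p + r) * (a - b)"
proof -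
  have "((\<lambda>x::real. p * \<bar>x\<bar> powr (p - 1)) \<longlongrightarrow> p * \<bar>1\<bar> powr (p - 1)) (nhds 1)"
    by (intro tendsto_intros filterlim_ident) auto
  then have "\<forall>\<^sub>F x in nhds 1. dist (p * \<bar>x\<bar> powr (p - 1)) p < d"
    using assms by (auto dest: tendstoD)
  then obtain e where e: "e > 0" "\<And>x. dist x 1 < e \<Longrightarrow> dist (p * \<bar>x\<bar> powr (p - 1)) p < d"
    by (auto simp: eventually_nhds_metric)
  show ?thesis
  proof (rule that[OF e(1)])
    fix a b assume ab: "\<bar>a - 1\<bar> < e" "\<bar>b - 1\<bar> < e"
    obtain z where z: "min a b \<le> z" "z \<le> max a b"
      "spow p a - spow p b = p * \<bar>z\<bar> powr (p - 1) * (a - b)"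
      using spow_mean_value[OF p, of a b] .
    have "dist z 1 < e" using z ab by (auto simp: dist_real_def)
    then have "\<bar>p * \<bar>z\<bar> powr (p - 1) - p\<bar> < d" using e(2) by (simp add: dist_real_def)
    then show "\<exists>r. \<bar>r\<bar> \<le> d \<and> spow p a - spow p b = (p + r) * (a - b)"
      using z(3) by (intro exI[of _ "p * \<bar>z\<bar> powr (p - 1) - p"]) auto
  qed
qed

text \<open>Convergence of \<open>y\<close> only makes \<open>v\<close> small at some time
  \<open>z\<close> in each interval \<open>(t - 1, t)\<close>. Monotonicity of the energy carries
  this from \<open>z\<close> to \<open>t\<close>, because the potential part \<open>P\<close>
  converges.\<close>

lemma deriv_tendsto_0:
  assumes sol: "sol y v" and lim: "(y \<longlongrightarrow> 1) at_bot"
  shows "(v \<longlongrightarrow> 0) at_bot"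
proof (rule tendstoI)
  fix e :: real assume e: "e > 0"
  define P where "P = (\<lambda>t. - (1 + m\<^sup>2 * exp (2 * m * t)) * (y t)\<^sup>2 / 2 + \<bar>y t\<bar> powr (p + 1) / (p + 1))"
  have E: "energy y v t = (v t)\<^sup>2 / 2 + P t" for t by (simp add: energy_def P_def field_simps)
  have "((\<lambda>t. m\<^sup>2 * exp (2 * m * t)) \<longlongrightarrow> 0) at_bot"
    using exp_small[of _ "m\<^sup>2"] by (intro tendstoI) (auto simp: dist_real_def)
  then have "(P \<longlongrightarrow> - (1 + 0) * 1\<^sup>2 / 2 + \<bar>1\<bar> powr (p + 1) / (p + 1)) at_bot"
    unfolding P_def using p by (intro tendsto_intros lim) auto
  then have P: "(P \<longlongrightarrow> - 1 / 2 + 1 / (p + 1)) at_bot" by simp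
  define l where "l = - 1 / 2 + 1 / (p + 1)"
  obtain T1 where T1: "\<And>t. t \<le> T1 \<Longrightarrow> dist (P t) l < e\<^sup>2 / 8"
    using tendstoD[OF P, of "e\<^sup>2 / 8"] e by (auto simp: eventually_at_bot_linorder l_def)
  obtain T2 where T2: "\<And>t. t \<le> T2 \<Longrightarrow> dist (y t) 1 < e / 4"
    using tendstoD[OF lim, of "e / 4"] e by (auto simp: eventually_at_bot_linorder)
  show "\<forall>\<^sub>F t in at_bot. dist (v t) 0 < e"
    unfolding eventually_at_bot_linorder
  proof (intro exI allI impI)
    fix t assume t: "t \<le> min T1 T2"
    obtain z where z: "t - 1 < z" "z < t" "y t - y (t - 1) = (t - (t - 1)) * v z"
      using MVT2[of "t - 1" t y v] solD(1)[OF sol] by auto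
    have "\<bar>v z\<bar> < e / 2"
    proof -
      have "\<bar>y t - 1\<bar> < e / 4" "\<bar>y (t - 1) - 1\<bar> < e / 4"
        using T2[of t] T2[of "t - 1"] t by (auto simp: dist_real_def)
      moreover have "v z = y t - y (t - 1)" using z by simp
      ultimately show ?thesis unfolding abs_less_iff by linarith
    qed
    then have "\<bar>v z\<bar>\<^sup>2 < (e / 2)\<^sup>2" by (intro power_strict_mono) auto
    then have "(v z)\<^sup>2 < e\<^sup>2 / 4" by (simp add: power_divide)
    moreover have "energy y v t \<le> energy y v z" using energy_antimono[OF sol] z by simp
    moreover have "P z - P t < e\<^sup>2 / 4"
    proof -
      have "\<bar>P z - l\<bar> < e\<^sup>2 / 8" "\<bar>P t - l\<bar> < e\<^sup>2 / 8"
        using T1[of z] T1[of t] t z by (auto simp: dist_real_def)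
      then show ?thesis unfolding abs_less_iff by linarith
    qed
    ultimately have "(v t)\<^sup>2 < e\<^sup>2"
      using zero_le_power2[of e] unfolding E by linarith
    then have "\<bar>v t\<bar> < e" using e by (intro power2_less_imp_less[of "\<bar>v t\<bar>"]) auto
    then show "dist (v t) 0 < e" by simp
  qed
qed

lemma sol_diff:
  assumes "sol y v" "sol ys vs"
  shows "((\<lambda>t. y t - ys t) has_real_derivative v t - vs t) (at t)"
    and "((\<lambda>t. v t - vs t) has_real_derivative
      - \<alpha> * (v t - vs t) + (1 + m\<^sup>2 * exp (2 * m * t)) * (y t - ys t) - (spow p (y t) - spow p (ys t))) (at t)"
proof -
  show "((\<lambda>t. y t - ys t) has_real_derivative v t - vs t) (at t)"
    by (intro DERIV_diff solD(1) assms)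
  show "((\<lambda>t. v t - vs t) has_real_derivative
      - \<alpha> * (v t - vs t) + (1 + m\<^sup>2 * exp (2 * m * t)) * (y t - ys t) - (spow p (y t) - spow p (ys t))) (at t)"
    by (rule DERIV_cong[OF DERIV_diff[OF solD(2)[OF assms(1)] solD(2)[OF assms(2)]]])
      (simp add: algebra_simps)
qed

text \<open>While both solutions are near 1, their difference obeys a damped oscillator equation
  with stiffness close to \<open>p - 1\<close>. \<open>trapped_decay\<close> shows at once that
  \<open>y\<close> stays near 1 and that the difference decays, with constants independent of
  \<open>y\<close> and \<open>a\<close>.\<close>

lemma attracted_to_singular_sol:
  assumes sols: "sol ys vs" and lim: "(ys \<longlongrightarrow> 1) at_bot"
  obtains \<eta> T c C where "\<eta> > 0" "c > 0" "C > 0" "T \<le> 0"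
    "\<And>y v a t. sol y v \<Longrightarrow> a \<le> t \<Longrightarrow> t \<le> T \<Longrightarrow> \<bar>y a - 1\<bar> < \<eta> \<Longrightarrow> \<bar>v a\<bar> < \<eta>
      \<Longrightarrow> (y t - ys t)\<^sup>2 + (v t - vs t)\<^sup>2 \<le> C * exp (- c * (t - a))"
proof -
  \<comment> \<open>The derivative of \<open>y powr p - y\<close> at the equilibrium 1.\<close>
  define \<beta> where "\<beta> = p - 1"
  define \<kappa> where "\<kappa> = min (min (\<alpha> / 4) (\<beta> / (4 * \<alpha>))) (sqrt (\<beta> / 4))"
  define d where "d = min (\<alpha> / 2) (min (\<beta> / 4) (\<kappa> * \<beta> / 2))"
  have \<beta>: "\<beta> > 0" using p by (simp add: \<beta>_def)
  have \<kappa>: "\<kappa> > 0" "\<kappa> \<le> \<alpha> / 4" using \<alpha> \<beta> by (auto simp: \<kappa>_def)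
  have "\<kappa> \<le> \<beta> / (4 * \<alpha>)" by (auto simp: \<kappa>_def)
  then have \<kappa>\<alpha>: "\<kappa> * \<alpha> \<le> \<beta> / 4" using \<alpha> by (simp add: field_simps)
  have "\<kappa>\<^sup>2 \<le> (sqrt (\<beta> / 4))\<^sup>2" using \<kappa>(1) by (intro power_mono) (auto simp: \<kappa>_def)
  then have \<kappa>2: "\<kappa>\<^sup>2 \<le> \<beta> / 4" using \<beta> by simp
  have d: "d > 0" "d \<le> \<alpha> / 2" "d \<le> \<beta> / 4" "d \<le> \<kappa> * \<beta> / 2" using \<alpha> \<beta> \<kappa> by (auto simp: d_def)
  \<comment> \<open>Half of the tolerance \<open>d\<close> goes to the linearisation error, the
    other half to \<open>m\<^sup>2 * exp (2 * m * t)\<close>.\<close>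
  obtain \<epsilon> where \<epsilon>: "\<epsilon> > 0" "\<And>a b. \<bar>a - 1\<bar> < \<epsilon> \<Longrightarrow> \<bar>b - 1\<bar> < \<epsilon> \<Longrightarrow>
      \<exists>r. \<bar>r\<bar> \<le> d / 2 \<and> spow p a - spow p b = (p + r) * (a - b)"
    using spow_linearization_at_1[of "d / 2"] d(1) by (metis half_gt_zero)
  \<comment> \<open>The level at which \<open>W t \<le> \<omega>\<close> still yields
    \<open>\<bar>x t\<bar> \<le> \<epsilon> / 2\<close>; with \<open>ys t\<close> within
    \<open>\<epsilon> / 2\<close> of 1 this puts \<open>y t\<close> where the linearisation is
    valid.\<close>
  define \<omega> where "\<omega> = \<beta> * \<epsilon>\<^sup>2 / 16"
  have \<omega>: "\<omega> > 0" using \<beta> \<epsilon> by (simp add: \<omega>_def)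
  \<comment> \<open>Initial differences below \<open>2 * \<eta>\<close> give
    \<open>W a \<le> 3 / 4 * \<omega>\<close>, strictly under the trapping level.\<close>
  define \<eta> where "\<eta> = sqrt (\<omega> / (4 * (1 + \<beta>)))"
  have \<eta>: "\<eta> > 0" "\<eta>\<^sup>2 = \<omega> / (4 * (1 + \<beta>))" using \<omega> \<beta> by (auto simp: \<eta>_def)
  have "\<forall>\<^sub>F t in at_bot. dist (ys t) 1 < min (\<epsilon> / 2) \<eta> \<and> dist (vs t) 0 < \<eta> \<and> m\<^sup>2 * exp (2 * m * t) < d / 2"
    using \<epsilon> \<eta> d by (intro eventually_conj tendstoD[OF lim] tendstoD[OF deriv_tendsto_0[OF sols lim]] exp_small) auto
  then obtain T where T: "T \<le> 0"
    "\<And>t. t \<le> T \<Longrightarrow> dist (ys t) 1 < min (\<epsilon> / 2) \<eta> \<and> dist (vs t) 0 < \<eta> \<and> m\<^sup>2 * exp (2 * m * t) < d / 2"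
    using eventually_at_bot_obtain by (metis (no_types, lifting))
  \<comment> \<open>The rate \<open>\<kappa> / 4\<close> for
    \<open>z\<^sup>2 + \<beta> * x\<^sup>2\<close> becomes \<open>\<kappa> / 3\<close> for
    \<open>W\<close>, since \<open>W\<close> is at most 3/4 of that sum.\<close>
  define c where "c = \<kappa> / 3"
  define C where "C = (4 + 4 / \<beta>) * \<omega>"
  have C: "C > 0" using \<beta> \<omega> by (simp add: C_def add_pos_pos)
  show ?thesis
  proof (rule that[OF \<eta>(1) _ C T(1), of c])
    show "c > 0" using \<kappa> by (simp add: c_def)
    fix y v a t
    assume sol: "sol y v" and t: "a \<le> t" "t \<le> T" and ya: "\<bar>y a - 1\<bar> < \<eta>" and va: "\<bar>v a\<bar> < \<eta>"
    define x where "x = (\<lambda>t. y t - ys t)"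
    define z where "z = (\<lambda>t. v t - vs t)"
    define z' where "z' = (\<lambda>t. - \<alpha> * z t + (1 + m\<^sup>2 * exp (2 * m * t)) * x t - (spow p (y t) - spow p (ys t)))"
    define W where "W = (\<lambda>t. (z t)\<^sup>2 / 2 + \<beta> * (x t)\<^sup>2 / 2 + \<kappa> * x t * z t)"
    define W' where "W' = (\<lambda>t. z t * z' t + \<beta> * x t * z t + \<kappa> * (z t * z t + x t * z' t))"
    have der: "(x has_real_derivative z t) (at t)" "(z has_real_derivative z' t) (at t)" for t
      using sol_diff[OF sol sols] unfolding x_def z_def z'_def by blast+
    have Wder: "(W has_real_derivative W' t) (at t)" for t
      unfolding W_def W'_def
      by (auto intro!: derivative_eq_intros der simp: power2_eq_square algebra_simps)
    have Wlow: "(z t)\<^sup>2 / 4 + \<beta> / 4 * (x t)\<^sup>2 \<le> W t" for t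
      unfolding W_def by (rule quadratic_form_bounds[OF \<beta> \<kappa>2])
    have Wup: "W t \<le> 3 / 4 * ((z t)\<^sup>2 + \<beta> * (x t)\<^sup>2)" for t
      unfolding W_def by (rule quadratic_form_bounds[OF \<beta> \<kappa>2])
    have Wnn: "W t \<ge> 0" for t using Wlow[of t] \<beta> by (smt (verit) mult_nonneg_nonneg divide_nonneg_pos zero_le_power2)
    have step: "W' t \<le> - c * W t" if t: "t \<le> T" "W t \<le> \<omega>" for t
    proof -
      have "\<beta> / 4 * (x t)\<^sup>2 \<le> \<beta> / 4 * (\<epsilon> / 2)\<^sup>2"
      proof -
        have "\<beta> / 4 * (x t)\<^sup>2 \<le> W t" using Wlow[of t] zero_le_power2[of "z t"] by linarith
        also have "\<dots> \<le> \<beta> / 4 * (\<epsilon> / 2)\<^sup>2" using t(2) by (simp add: \<omega>_def power_divide)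
        finally show ?thesis .
      qed
      then have "(x t)\<^sup>2 \<le> (\<epsilon> / 2)\<^sup>2" using \<beta> by simp
      then have "\<bar>x t\<bar> \<le> \<epsilon> / 2" using \<epsilon>(1) by (simp add: abs_le_square_iff[symmetric])
      moreover have ys: "\<bar>ys t - 1\<bar> < \<epsilon> / 2" using T(2)[OF t(1)] by (simp add: dist_real_def)
      ultimately have "\<bar>y t - 1\<bar> < \<epsilon>" unfolding x_def abs_less_iff abs_le_iff by linarith
      then obtain r where r: "\<bar>r\<bar> \<le> d / 2" "spow p (y t) - spow p (ys t) = (p + r) * x t"
        using \<epsilon>(2)[of "y t" "ys t"] ys \<epsilon>(1) by (auto simp: x_def)
      define r' where "r' = r - m\<^sup>2 * exp (2 * m * t)"
      have r': "\<bar>r'\<bar> \<le> d" using r(1) T(2)[OF t(1)] zero_le_power2[of m] exp_ge_zero[of "2 * m * t"]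
        mult_nonneg_nonneg[of "m\<^sup>2" "exp (2 * m * t)"]
        unfolding r'_def abs_le_iff by linarith
      have z': "z' t = - \<alpha> * z t - (\<beta> + r') * x t"
        unfolding z'_def r(2) r'_def \<beta>_def by (simp add: algebra_simps)
      have "W' t \<le> - (\<kappa> / 4) * ((z t)\<^sup>2 + \<beta> * (x t)\<^sup>2)"
        unfolding W'_def z' by (rule damped_oscillator_ineq[OF \<alpha> \<beta> \<kappa> \<kappa>\<alpha> d(2-4) r'])
      also have "\<dots> \<le> - c * W t"
        using mult_left_mono[OF Wup[of t], of c] \<kappa> by (simp add: c_def)
      finally show ?thesis .
    qed
    have aT: "a \<le> T" using t by simp
    have "\<bar>x a\<bar> < 2 * \<eta>" "\<bar>z a\<bar> < 2 * \<eta>"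
      using T(2)[OF aT] ya va by (auto simp: x_def z_def dist_real_def)
    then have "\<bar>x a\<bar>\<^sup>2 \<le> (2 * \<eta>)\<^sup>2" "\<bar>z a\<bar>\<^sup>2 \<le> (2 * \<eta>)\<^sup>2" by (intro power_mono; simp)+
    then have xz: "(x a)\<^sup>2 \<le> 4 * \<eta>\<^sup>2" "(z a)\<^sup>2 \<le> 4 * \<eta>\<^sup>2" by (simp_all add: power_mult_distrib)
    have "(z a)\<^sup>2 + \<beta> * (x a)\<^sup>2 \<le> 4 * \<eta>\<^sup>2 + \<beta> * (4 * \<eta>\<^sup>2)"
      using xz \<beta> by (intro add_mono mult_left_mono) auto
    also have "\<dots> = 4 * (1 + \<beta>) * \<eta>\<^sup>2" by (simp add: algebra_simps)
    also have "\<dots> = \<omega>" using \<beta> by (simp add: \<eta>(2))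
    finally have Wa: "W a < \<omega>" using Wup[of a] \<omega> by simp
    have "W t \<le> W a * exp (- c * (t - a))"
      by (rule trapped_decay[of a T W W' \<omega>]) (use Wder Wnn Wa step t \<kappa> in \<open>auto simp: c_def\<close>)
    also have "\<dots> \<le> \<omega> * exp (- c * (t - a))" using Wa by (intro mult_right_mono) auto
    finally have Wt: "W t \<le> \<omega> * exp (- c * (t - a))" .
    have "(x t)\<^sup>2 + (z t)\<^sup>2 \<le> (4 + 4 / \<beta>) * ((z t)\<^sup>2 / 4 + \<beta> / 4 * (x t)\<^sup>2)"
      using \<beta> by (simp add: field_simps)
    also have "\<dots> \<le> (4 + 4 / \<beta>) * (\<omega> * exp (- c * (t - a)))"
      using \<beta> Wlow[of t] Wt by (intro mult_left_mono) auto
    finally show "(y t - ys t)\<^sup>2 + (v t - vs t)\<^sup>2 \<le> C * exp (- c * (t - a))"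
      by (simp add: x_def z_def C_def mult.assoc)
  qed
qed

text \<open>Gronwall's inequality for the squared phase-space distance. The common bound
  \<open>B\<close> supplies a Lipschitz constant for the power, so that \<open>C\<close> is the same
  for all solutions within that bound.\<close>

lemma continuous_dependence:
  assumes sols: "sol ys vs"
  obtains C where "C > 0"
    "\<And>y v t. sol y v \<Longrightarrow> (\<And>t. T1 \<le> t \<Longrightarrow> t \<le> T2 \<Longrightarrow> \<bar>y t\<bar> \<le> B) \<Longrightarrow> T1 \<le> t \<Longrightarrow> t \<le> T2
      \<Longrightarrow> (y t - ys t)\<^sup>2 + (v t - vs t)\<^sup>2 \<le> C * ((y T1 - ys T1)\<^sup>2 + (v T1 - vs T1)\<^sup>2)"
proof -
  have "compact (ys ` {T1..T2})"
    by (intro compact_continuous_image continuous_at_imp_continuous_on ballI sol_isCont(1)[OF sols]) auto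
  then obtain Bs where Bs: "\<And>t. T1 \<le> t \<Longrightarrow> t \<le> T2 \<Longrightarrow> \<bar>ys t\<bar> \<le> Bs"
    using compact_imp_bounded[of "ys ` {T1..T2}"] by (auto simp: bounded_iff, metis atLeastAtMost_iff)
  define M where "M = max B Bs"
  define Lp where "Lp = p * M powr (p - 1)"
  define k0 where "k0 = 1 + m\<^sup>2 * exp (2 * m * T2)"
  \<comment> \<open>The damping only helps, and the other terms of the derivative of
    \<open>V\<close> are at most \<open>2 * D * \<bar>x s * z s\<bar>\<close>, hence at most
    \<open>D * V s\<close>.\<close>
  define D where "D = 1 + k0 + Lp"
  have Lp: "Lp \<ge> 0" using p by (simp add: Lp_def)
  have k0: "k0 \<ge> 1" by (simp add: k0_def)
  show ?thesis
  proof (rule that[of "exp (D * (T2 - T1))"])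
    fix y v t
    assume sol: "sol y v" and yB: "\<And>t. T1 \<le> t \<Longrightarrow> t \<le> T2 \<Longrightarrow> \<bar>y t\<bar> \<le> B" and t: "T1 \<le> t" "t \<le> T2"
    define x where "x = (\<lambda>t. y t - ys t)"
    define z where "z = (\<lambda>t. v t - vs t)"
    define z' where "z' = (\<lambda>t. - \<alpha> * z t + (1 + m\<^sup>2 * exp (2 * m * t)) * x t - (spow p (y t) - spow p (ys t)))"
    define V where "V = (\<lambda>t. (x t)\<^sup>2 + (z t)\<^sup>2)"
    have der: "(x has_real_derivative z t) (at t)" "(z has_real_derivative z' t) (at t)" for t
      using sol_diff[OF sol sols] unfolding x_def z_def z'_def by blast+
    have Vder: "(V has_real_derivative 2 * x t * z t + 2 * z t * z' t) (at t)" for t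
      unfolding V_def by (auto intro!: derivative_eq_intros der)
    have Vle: "2 * x s * z s + 2 * z s * z' s \<le> D * V s" if s: "T1 \<le> s" "s \<le> T2" for s
    proof -
      define k where "k = 1 + m\<^sup>2 * exp (2 * m * s)"
      have k: "0 \<le> k" "k \<le> k0" using s m by (auto simp: k_def k0_def mult_left_mono)
      have "\<bar>y s\<bar> \<le> M" "\<bar>ys s\<bar> \<le> M" using yB[OF s] Bs[OF s] by (auto simp: M_def)
      then have "\<bar>spow p (y s) - spow p (ys s)\<bar> \<le> Lp * \<bar>x s\<bar>"
        unfolding Lp_def x_def by (rule spow_lipschitz[OF p])
      then have "\<bar>z s\<bar> * \<bar>spow p (y s) - spow p (ys s)\<bar> \<le> \<bar>z s\<bar> * (Lp * \<bar>x s\<bar>)"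
        by (intro mult_left_mono) auto
      then have 1: "- (z s * (spow p (y s) - spow p (ys s))) \<le> Lp * \<bar>x s * z s\<bar>"
        by (simp flip: abs_mult add: abs_le_iff mult.left_commute mult.commute)
      have "(1 + k) * (x s * z s) \<le> (1 + k) * \<bar>x s * z s\<bar>" using k by (intro mult_left_mono) auto
      also have "\<dots> \<le> (1 + k0) * \<bar>x s * z s\<bar>" using k by (intro mult_right_mono) auto
      finally have 2: "(1 + k) * (x s * z s) \<le> (1 + k0) * \<bar>x s * z s\<bar>" .
      have "0 \<le> (\<bar>x s\<bar> - \<bar>z s\<bar>)\<^sup>2" by simp
      then have "2 * \<bar>x s * z s\<bar> \<le> V s" by (simp add: power2_diff abs_mult V_def)
      then have 3: "D * (2 * \<bar>x s * z s\<bar>) \<le> D * V s"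
        using k0 Lp by (intro mult_left_mono) (auto simp: D_def)
      have "2 * x s * z s + 2 * z s * z' s
        = 2 * ((1 + k) * (x s * z s) - z s * (spow p (y s) - spow p (ys s))) - 2 * (\<alpha> * (z s)\<^sup>2)"
        by (simp add: z'_def k_def algebra_simps power2_eq_square)
      also have "\<dots> \<le> 2 * ((1 + k) * (x s * z s) - z s * (spow p (y s) - spow p (ys s)))" using \<alpha> by simp
      also have "\<dots> \<le> 2 * ((1 + k0) * \<bar>x s * z s\<bar> + Lp * \<bar>x s * z s\<bar>)" using 1 2 by simp
      also have "\<dots> = D * (2 * \<bar>x s * z s\<bar>)" by (simp add: D_def algebra_simps)
      finally show ?thesis using 3 by simp
    qed
    have "exp (- D * t) * V t \<le> exp (- D * T1) * V T1"
    proof (rule DERIV_nonpos_imp_nonincreasing[OF t(1), of "\<lambda>t. exp (- D * t) * V t"])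
      fix s assume s: "T1 \<le> s" "s \<le> t"
      have "((\<lambda>t. exp (- D * t) * V t) has_real_derivative
          exp (- D * s) * ((2 * x s * z s + 2 * z s * z' s) - D * V s)) (at s)"
        by (auto intro!: derivative_eq_intros Vder simp: algebra_simps)
      moreover have "exp (- D * s) * ((2 * x s * z s + 2 * z s * z' s) - D * V s) \<le> 0"
        using Vle[of s] s t by (intro mult_nonneg_nonpos) auto
      ultimately show "\<exists>y. ((\<lambda>t. exp (- D * t) * V t) has_real_derivative y) (at s) \<and> y \<le> 0" by blast
    qed
    then have "exp (D * t) * (exp (- D * t) * V t) \<le> exp (D * t) * (exp (- D * T1) * V T1)"
      by (intro mult_left_mono) auto
    then have 1: "(exp (D * t) * exp (- D * t)) * V t \<le> (exp (D * t) * exp (- D * T1)) * V T1"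
      by (simp only: mult.assoc)
    have 2: "exp (D * t) * exp (- D * t) = 1" by (simp flip: exp_add)
    have 3: "exp (D * t) * exp (- D * T1) = exp (D * (t - T1))"
      unfolding exp_add[symmetric] by (simp add: right_diff_distrib)
    have "V t \<le> exp (D * (t - T1)) * V T1" using 1 unfolding 2 3 by simp
    also have "\<dots> \<le> exp (D * (T2 - T1)) * V T1"
      using t k0 Lp by (intro mult_right_mono) (auto simp: V_def D_def intro!: mult_left_mono)
    finally show "(y t - ys t)\<^sup>2 + (v t - vs t)\<^sup>2 \<le> exp (D * (T2 - T1)) * ((y T1 - ys T1)\<^sup>2 + (v T1 - vs T1)\<^sup>2)"
      by (simp add: V_def x_def z_def)
  qed auto
qed

text \<open>Trajectory \<open>j\<close> is near the equilibrium at some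
  \<open>s \<le> a j + L\<close>, so by the fixed time \<open>S\<close> its squared distance from
  \<open>ys\<close> is at most \<open>C * exp (d * (a j + (L - S)))\<close>, which tends to 0 as
  \<open>a j\<close> tends to \<open>-\<infinity>\<close>.\<close>

lemma locally_uniform_convergence:
  assumes sols: "sol ys vs" and lim: "(ys \<longlongrightarrow> 1) at_bot" and c: "c > 0" and e: "e > 0"
    and a: "filterlim a at_bot sequentially"
    and ev: "\<forall>\<^sub>F j in sequentially. sol (Y j) (V j) \<and> (\<forall>t. energy (Y j) (V j) t \<le> 0)
      \<and> energy (Y j) (V j) (a j) \<le> - c \<and> Y j (a j) > 0"
  shows "\<forall>\<^sub>F j in sequentially. \<forall>t\<in>{T1..T2}. \<bar>Y j t - ys t\<bar> < e \<and> \<bar>V j t - vs t\<bar> < e"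
proof -
  obtain \<eta> T d C where att: "\<eta> > 0" "d > 0" "C > 0" "T \<le> 0"
    "\<And>y v a t. sol y v \<Longrightarrow> a \<le> t \<Longrightarrow> t \<le> T \<Longrightarrow> \<bar>y a - 1\<bar> < \<eta> \<Longrightarrow> \<bar>v a\<bar> < \<eta>
      \<Longrightarrow> (y t - ys t)\<^sup>2 + (v t - vs t)\<^sup>2 \<le> C * exp (- d * (t - a))"
    using attracted_to_singular_sol[OF sols lim] by metis
  obtain L T0 where L: "L > 0" "T0 \<le> 0"
    "\<And>y v a. sol y v \<Longrightarrow> (\<And>t. energy y v t \<le> 0) \<Longrightarrow> energy y v a \<le> - c \<Longrightarrow> y a > 0
      \<Longrightarrow> a + L \<le> T0 \<Longrightarrow> \<exists>t. a \<le> t \<and> t \<le> a + L \<and> \<bar>y t - 1\<bar> < \<eta> \<and> \<bar>v t\<bar> < \<eta>"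
    using reaches_equilibrium[OF c att(1)] by metis
  \<comment> \<open>The time at which exponential decay hands over to continuous dependence: early
    enough for the former, and no later than the window \<open>{T1..T2}\<close>.\<close>
  define S where "S = min T T1"
  obtain B where B: "\<And>y v t. sol y v \<Longrightarrow> energy y v t \<le> 0 \<Longrightarrow> t \<le> T2 \<Longrightarrow> \<bar>y t\<bar> \<le> B \<and> \<bar>v t\<bar> \<le> B"
    using energy_nonpos_bounded[of T2] by metis
  obtain D where D: "D > 0"
    "\<And>y v t. sol y v \<Longrightarrow> (\<And>t. S \<le> t \<Longrightarrow> t \<le> T2 \<Longrightarrow> \<bar>y t\<bar> \<le> B) \<Longrightarrow> S \<le> t \<Longrightarrow> t \<le> T2
      \<Longrightarrow> (y t - ys t)\<^sup>2 + (v t - vs t)\<^sup>2 \<le> D * ((y S - ys S)\<^sup>2 + (v S - vs S)\<^sup>2)"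
    using continuous_dependence[OF sols, of S T2 B] by metis
  have "filterlim (\<lambda>j. (L - S) + a j) at_bot sequentially"
    using a by (simp add: filterlim_tendsto_add_at_bot_iff[OF tendsto_const])
  then have "filterlim (\<lambda>j. a j + (L - S)) at_bot sequentially" by (simp add: add.commute)
  then have "filterlim (\<lambda>j. d * (a j + (L - S))) at_bot sequentially"
    by (rule filterlim_tendsto_pos_mult_at_bot[OF tendsto_const att(2)])
  then have "((\<lambda>j. D * (C * exp (d * (a j + (L - S))))) \<longlongrightarrow> D * (C * 0)) sequentially"
    by (intro tendsto_intros filterlim_compose[OF exp_at_bot])
  then have "\<forall>\<^sub>F j in sequentially. D * (C * exp (d * (a j + (L - S)))) < e\<^sup>2"
    using e by (intro order_tendstoD(2)) auto
  moreover have "\<forall>\<^sub>F j in sequentially. a j \<le> min T0 S - L"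
    using a by (simp add: filterlim_at_bot)
  ultimately show ?thesis using ev
  proof eventually_elim
    case (elim j)
    then have sol: "sol (Y j) (V j)" and neg: "\<And>t. energy (Y j) (V j) t \<le> 0" by auto
    obtain s where s: "a j \<le> s" "s \<le> a j + L" "\<bar>Y j s - 1\<bar> < \<eta>" "\<bar>V j s\<bar> < \<eta>"
      using L(3)[OF sol neg, of "a j"] elim by (auto simp: min_def split: if_splits)
    have sS: "s \<le> S" "S \<le> T" using s elim by (auto simp: S_def)
    have "(Y j S - ys S)\<^sup>2 + (V j S - vs S)\<^sup>2 \<le> C * exp (- d * (S - s))"
      by (rule att(5)[OF sol sS s(3,4)])
    also have "- d * (S - s) = d * (s - S)" by (simp add: algebra_simps)
    also have "C * exp (d * (s - S)) \<le> C * exp (d * (a j + (L - S)))"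
      using att(2,3) s by (auto intro!: mult_left_mono)
    finally have 1: "D * ((Y j S - ys S)\<^sup>2 + (V j S - vs S)\<^sup>2) < e\<^sup>2"
      using elim(1) D(1) by (meson mult_left_mono less_imp_le order_le_less_trans)
    show ?case
    proof (intro ballI)
      fix t assume t: "t \<in> {T1..T2}"
      have "(Y j t - ys t)\<^sup>2 + (V j t - vs t)\<^sup>2 \<le> D * ((Y j S - ys S)\<^sup>2 + (V j S - vs S)\<^sup>2)"
        by (rule D(2)[OF sol]) (use B[OF sol neg] t in \<open>auto simp: S_def\<close>)
      with 1 have "(Y j t - ys t)\<^sup>2 + (V j t - vs t)\<^sup>2 < e\<^sup>2" by linarith
      then have "(Y j t - ys t)\<^sup>2 < e\<^sup>2" "(V j t - vs t)\<^sup>2 < e\<^sup>2"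
        using zero_le_power2[of "Y j t - ys t"] zero_le_power2[of "V j t - vs t"] by linarith+
      then show "\<bar>Y j t - ys t\<bar> < e \<and> \<bar>V j t - vs t\<bar> < e"
        using e by (auto intro: power2_less_imp_less)
    qed
  qed
qed

end

subsection \<open>The Emden--Fowler transformation\<close>

lemma spow_scale:
  assumes "c > 0"
  shows "spow p (c * x) = c powr (p - 1) * c * spow p x"
  using assms by (simp add: spow_def abs_mult powr_mult)

lemma uniform_limit_mult_continuous:
  fixes f :: "nat \<Rightarrow> real \<Rightarrow> real"
  assumes "compact K" "continuous_on K c" "continuous_on K l" "uniform_limit K f l F"
  shows "uniform_limit K (\<lambda>j s. c s * f j s) (\<lambda>s. c s * l s) F"
  using assms
  by (intro uniform_lim_mult uniform_limit_const compact_imp_bounded compact_continuous_image)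

lemma deriv_cong_open:
  fixes f g :: "real \<Rightarrow> real"
  assumes "open X" "x \<in> X" "\<And>x. x \<in> X \<Longrightarrow> f x = g x"
  shows "deriv f x = deriv g x"
  by (rule deriv_cong_ev) (use assms eventually_nhds_in_open[of X x] in \<open>auto elim!: eventually_mono\<close>)

locale supercritical =
  fixes N :: nat and p :: real
  assumes N: "N \<ge> 3" and p_gt: "p > pS N"
begin

abbreviation "\<theta> \<equiv> thetaC p"
abbreviation "A \<equiv> AC N p"
abbreviation "m \<equiv> mC N p"
abbreviation "\<alpha> \<equiv> alphaC N p"

text \<open>As \<open>pS N = 1 + 4 / (real N - 2)\<close>, supercriticality says
  \<open>2 * \<theta> < real N - 2\<close>, which is the positivity of the damping.\<close>

lemma p_gt_1: "p > 1" and theta_pos: "\<theta> > 0" and theta_lt: "2 * \<theta> < real N - 2"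
proof -
  have N2: "real N - 2 > 0" using N by simp
  have "pS N = 1 + 4 / (real N - 2)" using N2 by (simp add: pS_def field_simps)
  then have p4: "p - 1 > 4 / (real N - 2)" using p_gt by simp
  moreover have "4 / (real N - 2) > 0" using N2 by simp
  ultimately show p1: "p > 1" by linarith
  then show "\<theta> > 0" by (simp add: thetaC_def)
  show "2 * \<theta> < real N - 2" using p4 p1 N2 by (simp add: thetaC_def field_simps)
qed

lemma base_pos: "\<theta> * (real N - 2 - \<theta>) > 0"
  using theta_pos theta_lt by simp

lemma A_pos: "A > 0" and m_pos: "m > 0"
  using base_pos by (auto simp: AC_def mC_def)

lemma alpha_pos: "\<alpha> > 0"
  using m_pos theta_lt by (simp add: alphaC_def)

lemma m_square: "m\<^sup>2 * (\<theta> * (real N - 2 - \<theta>)) = 1"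
proof -
  have "m\<^sup>2 = (\<theta> * (real N - 2 - \<theta>)) powr (- 1)"
    using base_pos unfolding mC_def by (simp add: power2_eq_square flip: powr_add)
  then have "m\<^sup>2 = inverse (\<theta> * (real N - 2 - \<theta>))"
    using base_pos by (simp only: powr_minus powr_one less_imp_le)
  then show ?thesis using base_pos by (metis left_inverse less_irrefl)
qed

text \<open>With \<open>m_square\<close>, this is the normalisation that makes 1 an equilibrium of
  the autonomous part.\<close>

lemma A_powr: "A powr (p - 1) * m\<^sup>2 = 1"
proof -
  have "A powr (p - 1) = \<theta> * (real N - 2 - \<theta>)"
    using base_pos p_gt_1 unfolding AC_def by (simp add: powr_powr)
  then show ?thesis using m_square by (simp add: mult.commute)
qed

lemma theta_p: "\<theta> * (p - 1) = 2"
  unfolding thetaC_def using p_gt_1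
  by (subst times_divide_eq_left, subst nonzero_mult_div_cancel_right) auto

sublocale emden_fowler \<alpha> m p
  using alpha_pos m_pos p_gt_1 by unfold_locales

definition emden :: "(real \<Rightarrow> real) \<Rightarrow> real \<Rightarrow> real" where
  "emden u t = exp (m * \<theta> * t) * u (exp (m * t)) / A"

text \<open>The derivative of \<open>emden u\<close>, written out so that bounds on \<open>u\<close>
  and \<open>deriv u\<close> apply to it directly.\<close>

definition emden' :: "(real \<Rightarrow> real) \<Rightarrow> real \<Rightarrow> real" where
  "emden' u t = m * exp (m * \<theta> * t) * (\<theta> * u (exp (m * t)) + exp (m * t) * deriv u (exp (m * t))) / A"

lemma radial_solD:
  assumes "radial_sol N p g u" "s > 0"
  shows "(u has_real_derivative deriv u s) (at s)"
    and "(deriv u has_real_derivative - (real N - 1) / s * deriv u s + u s - spow p (u s)) (at s)"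
proof -
  have *: "u differentiable (at s)" "deriv u differentiable (at s)"
    "deriv (deriv u) s + (real N - 1) / s * deriv u s + fnl p (u s) = 0"
    using assms unfolding radial_sol_def by auto
  show "(u has_real_derivative deriv u s) (at s)"
    using *(1) by (simp add: DERIV_deriv_iff_real_differentiable)
  have "(deriv u has_real_derivative deriv (deriv u) s) (at s)"
    using *(2) by (simp add: DERIV_deriv_iff_real_differentiable)
  then show "(deriv u has_real_derivative - (real N - 1) / s * deriv u s + u s - spow p (u s)) (at s)"
    using *(3) unfolding fnl_def minus_divide_left[symmetric] mult_minus_left
    by (elim DERIV_cong) linarith
qed

text \<open>Two time derivatives of \<open>u (exp (m * t))\<close> produce the factor
  \<open>m\<^sup>2 * s\<^sup>2\<close>. Since \<open>\<theta> * (p - 1) = 2\<close>, the weight of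
  the power term absorbs it; the linear term of \<open>fnl\<close> keeps it and becomes the
  nonautonomous perturbation.\<close>

lemma emden_sol:
  assumes u: "radial_sol N p g u"
  shows "sol (emden u) (emden' u)"
  unfolding sol_def
proof (intro allI conjI)
  fix t
  define s where "s = exp (m * t)"
  define E where "E = exp (m * \<theta> * t)"
  have s: "s > 0" and E: "E > 0" by (auto simp: s_def E_def)
  have sder: "((\<lambda>t. exp (m * t)) has_real_derivative m * s) (at t)"
    unfolding s_def by (auto intro!: derivative_eq_intros)
  have Eder: "((\<lambda>t. exp (m * \<theta> * t)) has_real_derivative m * \<theta> * E) (at t)"
    unfolding E_def by (auto intro!: derivative_eq_intros)
  have u1: "((\<lambda>t. u (exp (m * t))) has_real_derivative deriv u s * (m * s)) (at t)"
    by (rule DERIV_chain2[OF _ sder]) (use radial_solD(1)[OF u s] in \<open>simp add: s_def\<close>)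
  have u2: "((\<lambda>t. deriv u (exp (m * t))) has_real_derivative
      (- (real N - 1) / s * deriv u s + u s - spow p (u s)) * (m * s)) (at t)"
    by (rule DERIV_chain2[OF _ sder]) (use radial_solD(2)[OF u s] in \<open>simp add: s_def\<close>)
  have "(emden u has_real_derivative (m * \<theta> * E * u s + deriv u s * (m * s) * E) / A) (at t)"
    unfolding emden_def by (rule DERIV_cong[OF DERIV_cdivide[OF DERIV_mult[OF Eder u1]]]) (simp add: s_def E_def)
  then show "(emden u has_real_derivative emden' u t) (at t)"
    by (rule DERIV_cong) (simp add: emden'_def s_def E_def algebra_simps)
  have 1: "(emden' u has_real_derivative
      (m * (m * \<theta> * E) * (\<theta> * u s + s * deriv u s)
        + (\<theta> * (deriv u s * (m * s)) + (m * s * deriv u s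
          + (- (real N - 1) / s * deriv u s + u s - spow p (u s)) * (m * s) * s)) * (m * E)) / A) (at t)"
    unfolding emden'_def
    by (rule DERIV_cong[OF DERIV_cdivide[OF DERIV_mult[OF DERIV_cmult[OF Eder]
      DERIV_add[OF DERIV_cmult[OF u1] DERIV_mult[OF sder u2]]]]]) (simp add: s_def E_def)
  have "E powr (p - 1) = exp (m * (\<theta> * (p - 1)) * t)"
    by (simp add: E_def powr_def mult_ac)
  also have "\<dots> = s\<^sup>2" unfolding theta_p by (simp add: s_def power2_eq_square flip: exp_add)
  finally have Ep: "E powr (p - 1) = s\<^sup>2" .
  have "(E / A) powr (p - 1) = s\<^sup>2 * m\<^sup>2"
    using A_powr A_pos E by (simp add: powr_divide Ep field_simps)
  then have sp: "spow p (emden u t) = s\<^sup>2 * m\<^sup>2 * (E / A) * spow p (u s)"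
    using spow_scale[of "E / A" p "u s"] E A_pos by (simp add: emden_def E_def s_def)
  have s2: "exp (2 * m * t) = s\<^sup>2" by (simp add: s_def power2_eq_square flip: exp_add)
  \<comment> \<open>Writing the coefficient 1 as this product turns the comparison with the chain
    rule into a rational identity.\<close>
  have msq: "E * u s / A = m\<^sup>2 * (\<theta> * (real N - 2 - \<theta>)) * (E * u s / A)" by (simp add: m_square)
  have "- \<alpha> * emden' u t + (1 + m\<^sup>2 * exp (2 * m * t)) * emden u t - spow p (emden u t)
    = - (m * (real N - 2 - 2 * \<theta>)) * (m * E * (\<theta> * u s + s * deriv u s) / A)
      + m\<^sup>2 * (\<theta> * (real N - 2 - \<theta>)) * (E * u s / A) + m\<^sup>2 * s\<^sup>2 * (E * u s / A) - s\<^sup>2 * m\<^sup>2 * (E / A) * spow p (u s)"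
    unfolding sp s2 msq[symmetric] by (simp add: alphaC_def emden_def emden'_def E_def s_def algebra_simps add_divide_distrib)
  also have "\<dots> = (m * (m * \<theta> * E) * (\<theta> * u s + s * deriv u s)
        + (\<theta> * (deriv u s * (m * s)) + (m * s * deriv u s
          + (- (real N - 1) / s * deriv u s + u s - spow p (u s)) * (m * s) * s)) * (m * E)) / A"
    using s A_pos by (simp add: field_simps power2_eq_square)
  finally show "(emden' u has_real_derivative - \<alpha> * emden' u t + (1 + m\<^sup>2 * exp (2 * m * t)) * emden u t
      - spow p (emden u t)) (at t)"
    using 1 by simp
qed

section \<open>Radial profiles and their derivatives in phase-plane variables\<close>

lemma ustar_emden:
  assumes "s > 0"
  shows "ustar_of N p (emden u) s = u s"
proof -
  have "s powr (- \<theta>) * exp (\<theta> * ln s) = 1"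
    using assms by (simp add: powr_def flip: exp_add)
  then show ?thesis using assms A_pos m_pos
    by (simp add: ustar_of_def emden_def mult.commute mult.left_commute)
qed

definition ustar1 :: "(real \<Rightarrow> real) \<Rightarrow> (real \<Rightarrow> real) \<Rightarrow> real \<Rightarrow> real" where
  "ustar1 y v s = A * s powr (- \<theta> - 1) * (- \<theta> * y (ln s / m) + v (ln s / m) / m)"

text \<open>The derivative of \<open>v\<close> is replaced by the right-hand side of the equation,
  so convergence of \<open>y\<close> and \<open>v\<close> alone yields convergence of second
  derivatives.\<close>

definition ustar2 :: "(real \<Rightarrow> real) \<Rightarrow> (real \<Rightarrow> real) \<Rightarrow> real \<Rightarrow> real" where
  "ustar2 y v s = A * s powr (- \<theta> - 2) *
     ((- \<theta> - 1) * (- \<theta> * y (ln s / m) + v (ln s / m) / m) - \<theta> * v (ln s / m) / m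
      + (- \<alpha> * v (ln s / m) + (1 + m\<^sup>2 * exp (2 * m * (ln s / m))) * y (ln s / m) - spow p (y (ln s / m))) / m\<^sup>2)"

lemma ustar_derivs:
  assumes sol: "sol y v" and s: "s > 0"
  shows "(ustar_of N p y has_real_derivative ustar1 y v s) (at s)"
    and "(ustar1 y v has_real_derivative ustar2 y v s) (at s)"
proof -
  have ln: "((\<lambda>s. ln s / m) has_real_derivative 1 / s / m) (at s)"
    by (rule DERIV_cdivide[OF DERIV_ln_divide[OF s]])
  note y = DERIV_chain2[OF solD(1)[OF sol] ln] and v = DERIV_chain2[OF solD(2)[OF sol] ln]
  have m0: "m \<noteq> 0" using m_pos by simp
  have pw: "s powr (- \<theta> - 1) = s powr (- \<theta>) / s" "s powr (- \<theta> - 2) = s powr (- \<theta>) / s\<^sup>2"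
    using s powr_diff[of s "- \<theta>" 1] powr_diff[of s "- \<theta>" 2] by (simp_all add: powr_numeral)
  have pw': "s powr (- \<theta> - 1 - 1) = s powr (- \<theta>) / s\<^sup>2"
    unfolding pw(2)[symmetric] by (rule arg_cong[of _ _ "\<lambda>r. s powr r"]) simp
  show "(ustar_of N p y has_real_derivative ustar1 y v s) (at s)"
    unfolding ustar_of_def
    by (rule DERIV_cong[OF DERIV_mult[OF DERIV_cmult[OF has_real_derivative_powr[OF s]] y]])
      (use s m0 in \<open>simp add: ustar1_def pw field_simps\<close>)
  show "(ustar1 y v has_real_derivative ustar2 y v s) (at s)"
    unfolding ustar1_def
    by (rule DERIV_cong[OF DERIV_mult[OF DERIV_cmult[OF has_real_derivative_powr[OF s]]
            DERIV_add[OF DERIV_cmult[OF y] DERIV_cdivide[OF v]]]])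
      (use s m0 in \<open>simp add: ustar2_def pw pw' field_simps power2_eq_square\<close>)
qed

lemma ustar_deriv_eq:
  assumes sol: "sol y v" and s: "s > 0"
  shows "deriv (ustar_of N p y) s = ustar1 y v s"
    and "deriv (deriv (ustar_of N p y)) s = ustar2 y v s"
proof -
  have 1: "deriv (ustar_of N p y) s = ustar1 y v s" if "s > 0" for s
    using ustar_derivs(1)[OF sol that] by (rule DERIV_imp_deriv)
  show "deriv (ustar_of N p y) s = ustar1 y v s" by (rule 1[OF s])
  have "deriv (deriv (ustar_of N p y)) s = deriv (ustar1 y v) s"
    by (rule deriv_cong_open[of "{0<..}"]) (use s 1 in auto)
  then show "deriv (deriv (ustar_of N p y)) s = ustar2 y v s"
    using ustar_derivs(2)[OF sol s] by (simp add: DERIV_imp_deriv)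
qed

text \<open>The logarithm maps \<open>K\<close> into a bounded time interval, and all three profiles
  are linear in \<open>y\<close>, \<open>v\<close> and \<open>spow p y\<close> with coefficients
  continuous, hence bounded, on \<open>K\<close>.\<close>

lemma uniform_limits_of_phase_space:
  assumes sols: "sol y v" and Y: "\<And>j. sol (Y j) (V j)"
    and conv: "\<And>T1 T2 e. e > 0 \<Longrightarrow> \<forall>\<^sub>F j in sequentially. \<forall>t\<in>{T1..T2}. \<bar>Y j t - y t\<bar> < e \<and> \<bar>V j t - v t\<bar> < e"
    and K: "compact K" "K \<subseteq> {0<..}"
  shows "uniform_limit K (\<lambda>j. ustar_of N p (Y j)) (ustar_of N p y) sequentially"
    and "uniform_limit K (\<lambda>j. ustar1 (Y j) (V j)) (ustar1 y v) sequentially"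
    and "uniform_limit K (\<lambda>j. ustar2 (Y j) (V j)) (ustar2 y v) sequentially"
proof -
  define \<tau> where "\<tau> = (\<lambda>s. ln s / m)"
  have \<tau>: "ln s / m = \<tau> s" for s by (simp add: \<tau>_def)
  have \<tau>c: "continuous_on K \<tau>" unfolding \<tau>_def using K m_pos by (intro continuous_intros) auto
  have cont: "continuous_on X y" "continuous_on X v" for X
    using sol_isCont[OF sols] by (auto intro: continuous_at_imp_continuous_on)
  have yc: "continuous_on K (\<lambda>s. y (\<tau> s))" and vc: "continuous_on K (\<lambda>s. v (\<tau> s))"
    by (rule continuous_on_compose2[OF cont(1)[of UNIV] \<tau>c] continuous_on_compose2[OF cont(2)[of UNIV] \<tau>c],
        simp)+
  have sc: "continuous_on K (\<lambda>s. spow p (y (\<tau> s)))"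
    by (rule continuous_on_compose2[OF continuous_on_spow[of p UNIV, OF p_gt_1] yc]) simp
  have "bounded (\<tau> ` K)" using \<tau>c K by (intro compact_imp_bounded compact_continuous_image)
  then obtain T where "\<forall>s\<in>K. \<bar>\<tau> s\<bar> \<le> T" by (auto simp: bounded_iff)
  then have T: "\<And>s. s \<in> K \<Longrightarrow> \<tau> s \<in> {-T..T}" by (simp add: abs_le_iff minus_le_iff)
  have near: "\<forall>\<^sub>F j in sequentially. \<forall>s\<in>K. \<bar>Y j (\<tau> s) - y (\<tau> s)\<bar> < e \<and> \<bar>V j (\<tau> s) - v (\<tau> s)\<bar> < e"
    if "e > 0" for e
    using conv[OF that, of "-T" T] by eventually_elim (use T in blast)
  have uy: "uniform_limit K (\<lambda>j s. Y j (\<tau> s)) (\<lambda>s. y (\<tau> s)) sequentially"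
    and uv: "uniform_limit K (\<lambda>j s. V j (\<tau> s)) (\<lambda>s. v (\<tau> s)) sequentially"
    by (auto simp: uniform_limit_iff dist_real_def intro: eventually_mono[OF near])
  obtain B where B: "\<And>s. s \<in> K \<Longrightarrow> \<bar>y (\<tau> s)\<bar> \<le> B"
    using compact_imp_bounded[OF compact_continuous_image[OF yc K(1)]] by (auto simp: bounded_iff)
  \<comment> \<open>Eventually all values lie within 1 of those of the limit, in an interval where
    \<open>spow p\<close> is uniformly continuous.\<close>
  have us: "uniform_limit K (\<lambda>j s. spow p (Y j (\<tau> s))) (\<lambda>s. spow p (y (\<tau> s))) sequentially"
  proof (rule uniform_limit_compose_uniformly_continuous_on[OF uy])
    show "uniformly_continuous_on {- (B + 1)..B + 1} (spow p)"
      by (intro compact_uniformly_continuous continuous_on_spow p_gt_1 compact_Icc)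
    have 1: "a \<in> {- (B + 1)..B + 1}" if "\<bar>a - b\<bar> < 1" "\<bar>b\<bar> \<le> B" for a b
      using that by (simp add: abs_le_iff abs_less_iff)
    show "\<forall>\<^sub>F j in sequentially. \<forall>s\<in>K. Y j (\<tau> s) \<in> {- (B + 1)..B + 1}"
      using near[OF zero_less_one] by eventually_elim (use 1 B in blast)
  qed simp
  note lim = uniform_limit_mult_continuous[OF K(1) _ yc uy]
    uniform_limit_mult_continuous[OF K(1) _ vc uv] uniform_limit_mult_continuous[OF K(1) _ sc us]
  have comb: "uniform_limit K (\<lambda>j s. a s * Y j (\<tau> s) + b s * V j (\<tau> s) + c s * spow p (Y j (\<tau> s)))
      (\<lambda>s. a s * y (\<tau> s) + b s * v (\<tau> s) + c s * spow p (y (\<tau> s))) sequentially"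
    if "continuous_on K a" "continuous_on K b" "continuous_on K c" for a b c
    using that by (intro uniform_limit_add lim)
  have pc: "continuous_on K (\<lambda>s. s powr r)" for r using K by (intro continuous_intros) auto
  have ec: "continuous_on K (\<lambda>s. 1 + m\<^sup>2 * exp (2 * m * \<tau> s))" by (intro continuous_intros \<tau>c)
  have m0: "m \<noteq> 0" using m_pos by simp
  have u0: "ustar_of N p y = (\<lambda>s. A * s powr (- \<theta>) * y (\<tau> s))" for y
    by (rule ext) (simp add: ustar_of_def \<tau>)
  show "uniform_limit K (\<lambda>j. ustar_of N p (Y j)) (ustar_of N p y) sequentially"
    unfolding u0 by (intro lim(1) continuous_intros pc)
  have u1: "ustar1 y v = (\<lambda>s. A * s powr (- \<theta> - 1) * (- \<theta>) * y (\<tau> s)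
      + A * s powr (- \<theta> - 1) * (1 / m) * v (\<tau> s) + 0 * spow p (y (\<tau> s)))" for y v
    by (rule ext) (use m0 in \<open>simp add: ustar1_def \<tau> field_simps\<close>)
  show "uniform_limit K (\<lambda>j. ustar1 (Y j) (V j)) (ustar1 y v) sequentially"
    unfolding u1 by (intro comb continuous_intros pc)
  have u2: "ustar2 y v = (\<lambda>s. A * s powr (- \<theta> - 2) * ((- \<theta> - 1) * (- \<theta>) + (1 + m\<^sup>2 * exp (2 * m * \<tau> s)) / m\<^sup>2) * y (\<tau> s)
      + A * s powr (- \<theta> - 2) * ((- \<theta> - 1) / m - \<theta> / m - \<alpha> / m\<^sup>2) * v (\<tau> s)
      + A * s powr (- \<theta> - 2) * (- 1 / m\<^sup>2) * spow p (y (\<tau> s)))" for y v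
  proof -
    have "P * ((- \<theta> - 1) * (- \<theta> * a + b / M) - \<theta> * b / M + (- \<alpha> * b + k * a - w) / Q)
      = P * ((- \<theta> - 1) * (- \<theta>) + k / Q) * a + P * ((- \<theta> - 1) / M - \<theta> / M - \<alpha> / Q) * b
        + P * (- 1 / Q) * w" for P a b k w M Q
    proof -
      \<comment> \<open>With the reciprocals as variables \<open>i\<close> and \<open>j\<close> the
        identity is polynomial and needs no nonvanishing condition.\<close>
      have "P * ((- \<theta> - 1) * (- \<theta> * a + b * i) - \<theta> * b * i + (- \<alpha> * b + k * a - w) * j)
        = P * ((- \<theta> - 1) * (- \<theta>) + k * j) * a + P * ((- \<theta> - 1) * i - \<theta> * i - \<alpha> * j) * b
          + P * (- 1 * j) * w" for i j
        by algebra
      then show ?thesis unfolding divide_inverse .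
    qed
    then show ?thesis unfolding ustar2_def[abs_def] \<tau> by (intro ext)
  qed
  show "uniform_limit K (\<lambda>j. ustar2 (Y j) (V j)) (ustar2 y v) sequentially"
    unfolding u2
  proof (rule comb)
    have ap: "continuous_on K (\<lambda>s. A * s powr r)" for r by (rule continuous_on_mult_left[OF pc])
    show "continuous_on K (\<lambda>s. A * s powr (- \<theta> - 2) *
        ((- \<theta> - 1) * (- \<theta>) + (1 + m\<^sup>2 * exp (2 * m * \<tau> s)) / m\<^sup>2))"
      by (intro continuous_on_mult[OF ap] continuous_on_add continuous_on_const continuous_on_divide ec)
        (use m0 in simp)
    \<comment> \<open>The two remaining coefficients are both of this shape, so the same fact
      discharges both goals.\<close>
    show "continuous_on K (\<lambda>s. A * s powr (- \<theta> - 2) * c)" for c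
      by (rule continuous_on_mult_right[OF ap])
    then show "continuous_on K (\<lambda>s. A * s powr (- \<theta> - 2) * c)" for c .
  qed
qed

subsection \<open>Regular solutions near the origin\<close>

text \<open>The energy \<open>e\<close> of the radial equation decreases from \<open>F g\<close>.
  The potential \<open>F\<close> is even and, as \<open>g > 1\<close>, increasing beyond
  \<open>g\<close>, so \<open>\<bar>u s\<bar> > g\<close> would exceed that level.\<close>

lemma radial_sol_le_initial:
  assumes u: "radial_sol N p g u" and g: "g > 1" and s: "s > 0"
  shows "\<bar>u s\<bar> \<le> g"
proof (rule ccontr)
  assume neg: "\<not> \<bar>u s\<bar> \<le> g"
  define F where "F = (\<lambda>x. - x\<^sup>2 / 2 + \<bar>x\<bar> powr (p + 1) / (p + 1))"
  define e where "e = (\<lambda>s. (deriv u s)\<^sup>2 / 2 + F (u s))"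
  have Fder: "(F has_real_derivative - x + spow p x) (at x)" for x
  proof -
    have 1: "((\<lambda>x. \<bar>x\<bar> powr (p + 1) / (p + 1)) has_real_derivative spow p x) (at x)"
      using DERIV_cdivide[OF has_real_derivative_abs_powr[OF p_gt_1], of "p + 1"] p_gt_1 by simp
    have 2: "((\<lambda>x. - x\<^sup>2 / 2) has_real_derivative - x) (at x)"
      by (auto intro!: derivative_eq_intros)
    show ?thesis unfolding F_def by (rule DERIV_add[OF 2 1])
  qed
  have eder: "(e has_real_derivative - (real N - 1) / s * (deriv u s)\<^sup>2) (at s)" if "s > 0" for s
  proof -
    have 1: "((\<lambda>s. F (u s)) has_real_derivative (- u s + spow p (u s)) * deriv u s) (at s)"
      by (rule DERIV_chain2[OF Fder radial_solD(1)[OF u that]])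
    have 2: "((\<lambda>s. (deriv u s)\<^sup>2 / 2) has_real_derivative
        deriv u s * (- (real N - 1) / s * deriv u s + u s - spow p (u s))) (at s)"
      by (auto intro!: derivative_eq_intros radial_solD(2)[OF u that])
    show ?thesis unfolding e_def
      by (rule DERIV_cong[OF DERIV_add[OF 2 1]]) (simp add: algebra_simps power2_eq_square)
  qed
  have mono: "e s \<le> e r" if "0 < r" "r \<le> s" for r
  proof (rule DERIV_nonpos_imp_nonincreasing[OF that(2)])
    fix x assume x: "r \<le> x" "x \<le> s"
    have "- (real N - 1) / x * (deriv u x)\<^sup>2 \<le> 0"
      using x that N by (intro mult_nonpos_nonneg divide_nonpos_pos) auto
    then show "\<exists>z. (e has_real_derivative z) (at x) \<and> z \<le> 0" using eder[of x] x that by (intro exI conjI) auto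
  qed
  have u0: "(u \<longlongrightarrow> g) (at_right 0)" "(deriv u \<longlongrightarrow> 0) (at_right 0)"
  proof -
    have "(u \<longlongrightarrow> u 0) (at 0 within {0..})"
      using u unfolding radial_sol_def continuous_on_def by auto
    then have "(u \<longlongrightarrow> u 0) (at 0 within {0<..})" by (rule tendsto_within_subset) auto
    then show "(u \<longlongrightarrow> g) (at_right 0)" using u unfolding radial_sol_def by simp
    show "(deriv u \<longlongrightarrow> 0) (at_right 0)" using u unfolding radial_sol_def by simp
  qed
  have Flim: "((\<lambda>s. F (u s)) \<longlongrightarrow> F g) (at_right 0)"
    by (rule isCont_tendsto_compose[OF DERIV_isCont[OF Fder] u0(1)])
  have "(e \<longlongrightarrow> 0\<^sup>2 / 2 + F g) (at_right 0)"
    unfolding e_def by (intro tendsto_intros u0 Flim) auto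
  \<comment> \<open>The coefficient \<open>(N - 1) / s\<close> is singular at 0, so the comparison
    with the initial value passes through a limit.\<close>
  moreover have "\<forall>\<^sub>F r in at_right 0. e s \<le> e r"
    using mono s by (auto simp: eventually_at_right_field intro!: exI[of _ s])
  ultimately have "e s \<le> 0\<^sup>2 / 2 + F g"
    by (rule tendsto_lowerbound) simp
  then have "F (u s) \<le> F g" using zero_le_power2[of "deriv u s"] unfolding e_def power_zero_numeral by linarith
  moreover have "F g < F \<bar>u s\<bar>"
  proof (rule DERIV_pos_imp_increasing[where f = F])
    show "g < \<bar>u s\<bar>" using neg by simp
    fix x assume x: "g \<le> x" "x \<le> \<bar>u s\<bar>"
    have "x powr (p - 1) > 1" using x g p_gt_1 by (intro gr_one_powr) auto
    then have "- x + spow p x > 0" using x g by (simp add: spow_def)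
    then show "\<exists>y. (F has_real_derivative y) (at x) \<and> 0 < y" using Fder by blast
  qed
  moreover have "F \<bar>u s\<bar> = F (u s)" by (simp add: F_def)
  ultimately show False by simp
qed

text \<open>Integrate the equation in divergence form, with the nonlinearity bounded above by
  \<open>g powr p\<close> through \<open>radial_sol_le_initial\<close>. The second bound comes from
  the mean value theorem, which loses a factor 2 against integration.\<close>

lemma radial_sol_lower_bounds:
  assumes u: "radial_sol N p g u" and g: "g > 1" and s: "s > 0"
  shows "deriv u s \<ge> - (g powr p * s / real N)" "u s \<ge> g - g powr p * s\<^sup>2 / real N"
proof -
  define n where "n = real N - 1"
  have n: "n > 0" "real N = n + 1" using N by (auto simp: n_def)
  have d0: "(deriv u \<longlongrightarrow> 0) (at_right 0)" and u0: "continuous_on {0..} u" "u 0 = g"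
    using u unfolding radial_sol_def by auto
  have fle: "spow p (u x) - u x \<le> g powr p" if x: "x > 0" for x
  proof (cases "u x \<ge> 0")
    case True
    have "spow p (u x) \<le> g powr (p - 1) * g"
      using radial_sol_le_initial[OF u g x] True p_gt_1 unfolding spow_def
      by (intro mult_mono powr_mono2) auto
    also have "\<dots> = g powr p" using g by (simp add: powr_diff)
    finally show ?thesis using True by simp
  next
    case False
    then have "spow p (u x) \<le> 0" by (simp add: spow_def mult_nonneg_nonpos)
    moreover have "- u x \<le> g" using radial_sol_le_initial[OF u g x] by simp
    moreover have "g powr 1 \<le> g powr p" using g p_gt_1 by (intro powr_mono) auto
    ultimately show ?thesis using g by simp
  qed
  have dlow: "deriv u s \<ge> - (g powr p * s / real N)" if s: "s > 0" for s
  proof -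
    \<comment> \<open>Replaces the integral: \<open>s powr n\<close> is the integrating factor, the
      second term compensates the bound \<open>g powr p\<close>, and \<open>h\<close> is
      nondecreasing with limit 0 at the origin.\<close>
    define h where "h = (\<lambda>s. s powr n * deriv u s + g powr p / real N * s powr (n + 1))"
    have hder: "(h has_real_derivative s powr n * (g powr p - (spow p (u s) - u s))) (at s)" if "s > 0" for s
    proof -
      have pw: "s powr (n - 1) = s powr n / s" using that by (simp add: powr_diff)
      then show ?thesis unfolding h_def
        by (intro DERIV_cong[OF DERIV_add[OF DERIV_mult[OF has_real_derivative_powr[OF that] radial_solD(2)[OF u that]]
            DERIV_cmult[OF has_real_derivative_powr[OF that]]]])
          (use that n(1) in \<open>simp add: pw n(2), simp add: field_simps\<close>)
    qed
    have mono: "h r \<le> h s" if r: "0 < r" "r \<le> s" for r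
    proof (rule DERIV_nonneg_imp_nondecreasing[OF r(2)])
      fix x assume x: "r \<le> x" "x \<le> s"
      then have "x powr n * (g powr p - (spow p (u x) - u x)) \<ge> 0" using fle[of x] r by simp
      then show "\<exists>y. (h has_real_derivative y) (at x) \<and> 0 \<le> y" using hder[of x] x r by force
    qed
    have pw: "((\<lambda>s::real. s powr r) \<longlongrightarrow> 0) (at_right 0)" if "r > 0" for r
    proof -
      have "((\<lambda>s::real. \<bar>s\<bar> powr r) \<longlongrightarrow> 0) (at_right 0)"
        using abs_powr_tendsto_0[OF that] by (rule tendsto_within_subset) auto
      then show ?thesis
        by (rule Lim_transform_eventually) (auto simp: eventually_at_right_field intro!: exI[of _ 1])
    qed
    have "(h \<longlongrightarrow> 0 * 0 + g powr p / real N * 0) (at_right 0)"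
      unfolding h_def using n by (intro tendsto_intros d0 pw) auto
    moreover have "\<forall>\<^sub>F r in at_right 0. h r \<le> h s"
      using mono s by (auto simp: eventually_at_right_field intro!: exI[of _ s])
    ultimately have "0 * 0 + g powr p / real N * 0 \<le> h s"
      by (rule tendsto_upperbound) simp
    then have "0 \<le> s powr n * (deriv u s + g powr p / real N * s)"
      using s by (simp add: h_def powr_add algebra_simps)
    then have "0 \<le> deriv u s + g powr p / real N * s"
      using s by (simp add: zero_le_mult_iff)
    then show ?thesis by simp
  qed
  show "deriv u s \<ge> - (g powr p * s / real N)" by (rule dlow[OF s])
  have "continuous_on {0..s} u" by (rule continuous_on_subset[OF u0(1)]) auto
  moreover have "u differentiable (at x)" if "0 < x" for x
    using radial_solD(1)[OF u that] by (auto simp: real_differentiable_def)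
  ultimately obtain l z where z: "0 < z" "z < s" "DERIV u z :> l" "u s - u 0 = (s - 0) * l"
    using MVT[OF s, of u] by auto
  have "l = deriv u z" using z(3) by (simp add: DERIV_imp_deriv)
  moreover have "g powr p * z / real N \<le> g powr p * s / real N"
    using z by (intro divide_right_mono mult_left_mono) auto
  ultimately have "l \<ge> - (g powr p * s / real N)" using dlow[OF z(1)] by linarith
  then have "s * l \<ge> s * - (g powr p * s / real N)" using s by (intro mult_left_mono) auto
  then show "u s \<ge> g - g powr p * s\<^sup>2 / real N"
    using z(4) u0 by (simp add: power2_eq_square algebra_simps)
qed

text \<open>The weight \<open>exp (m * \<theta> * t)\<close> sends \<open>emden u\<close> and its
  derivative to 0 at \<open>-\<infinity>\<close>, because \<open>u\<close> and
  \<open>deriv u\<close> have finite limits at the origin; the energy starts from 0 and cannot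
  increase.\<close>

lemma emden_energy_nonpos:
  assumes u: "radial_sol N p g u"
  shows "energy (emden u) (emden' u) t \<le> 0"
proof -
  have et: "((\<lambda>t. exp (c * t)) \<longlongrightarrow> 0) at_bot" if "c > 0" for c :: real
    using that by (intro exp_at_bot[THEN filterlim_compose] filterlim_tendsto_pos_mult_at_bot[of _ c])
      (auto intro!: filterlim_ident)
  have right: "filterlim (\<lambda>t. exp (m * t)) (at_right 0) at_bot"
    using et[OF m_pos] by (auto simp: filterlim_at)
  have "(u \<longlongrightarrow> u 0) (at 0 within {0..})"
    using u unfolding radial_sol_def continuous_on_def by auto
  then have "(u \<longlongrightarrow> u 0) (at 0 within {0<..})" by (rule tendsto_within_subset) auto
  then have ul: "((\<lambda>t. u (exp (m * t))) \<longlongrightarrow> u 0) at_bot" by (rule filterlim_compose[OF _ right])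
  have "(deriv u \<longlongrightarrow> 0) (at_right 0)" using u unfolding radial_sol_def by simp
  then have dl: "((\<lambda>t. deriv u (exp (m * t))) \<longlongrightarrow> 0) at_bot" by (rule filterlim_compose[OF _ right])
  have mt: "m * \<theta> > 0" using m_pos theta_pos by simp
  have yl: "(emden u \<longlongrightarrow> 0 * u 0 / A) at_bot"
    unfolding emden_def using A_pos by (intro tendsto_intros et mt ul) auto
  have vl: "(emden' u \<longlongrightarrow> m * 0 * (\<theta> * u 0 + 0 * 0) / A) at_bot"
    unfolding emden'_def using A_pos by (intro tendsto_intros et mt m_pos ul dl) auto
  have y0: "(emden u \<longlongrightarrow> 0) at_bot" and v0: "(emden' u \<longlongrightarrow> 0) at_bot" using yl vl by simp_all
  have pl: "((\<lambda>t. \<bar>emden u t\<bar> powr (p + 1)) \<longlongrightarrow> \<bar>0\<bar> powr (p + 1)) at_bot"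
    by (rule isCont_tendsto_compose[OF DERIV_isCont[OF has_real_derivative_abs_powr[OF p_gt_1]] y0])
  have "2 * m > 0" using m_pos by simp
  then have "(energy (emden u) (emden' u) \<longlongrightarrow>
      0\<^sup>2 / 2 - (1 + m\<^sup>2 * 0) * 0\<^sup>2 / 2 + \<bar>0\<bar> powr (p + 1) / (p + 1)) at_bot"
    unfolding energy_def[abs_def] using p_gt_1
    by (intro tendsto_intros et y0 v0 pl) auto
  then have "(energy (emden u) (emden' u) \<longlongrightarrow> 0) at_bot" by simp
  moreover have "\<forall>\<^sub>F r in at_bot. energy (emden u) (emden' u) t \<le> energy (emden u) (emden' u) r"
    using energy_antimono[OF emden_sol[OF u]] by (auto simp: eventually_at_bot_linorder)
  ultimately show ?thesis by (rule tendsto_lowerbound) simp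
qed

text \<open>The solution of \<open>\<theta> * (1 - \<kappa>\<^sup>2 / N) - \<kappa>\<^sup>2 / N =
  \<theta> / 2\<close>: up to radius \<open>\<kappa> * g powr (- (p - 1) / 2)\<close> the lower
  bounds keep \<open>\<theta> * u s + s * deriv u s\<close> at least
  \<open>g * (\<theta> / 2)\<close>.\<close>

definition \<kappa> :: real where "\<kappa> = sqrt (real N * \<theta> / (2 * (\<theta> + 1)))"

text \<open>The time whose radius \<open>exp (m * start g)\<close> equals
  \<open>\<kappa> * g powr (- (p - 1) / 2)\<close>.\<close>

definition start :: "real \<Rightarrow> real" where "start g = (ln \<kappa> - (p - 1) / 2 * ln g) / m"

lemma kappa: "\<kappa> > 0" "\<kappa>\<^sup>2 / real N * (\<theta> + 1) = \<theta> / 2" "\<kappa>\<^sup>2 / real N \<le> 1 / 2"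
proof -
  have 1: "real N > 0" "\<theta> + 1 > 0" using N theta_pos by auto
  then show "\<kappa> > 0" using theta_pos by (simp add: \<kappa>_def)
  have k2: "\<kappa>\<^sup>2 = real N * \<theta> / (2 * (\<theta> + 1))" using 1 theta_pos by (simp add: \<kappa>_def)
  have k: "\<kappa>\<^sup>2 / real N = \<theta> / (2 * (\<theta> + 1))" unfolding k2 using 1 by simp
  have "\<theta> / (2 * q) * q = \<theta> / 2" if "q > 0" for q using that by simp
  from this[OF 1(2)] show "\<kappa>\<^sup>2 / real N * (\<theta> + 1) = \<theta> / 2" unfolding k .
  have "\<theta> / (2 * q) \<le> 1 / 2" if "q > 0" "\<theta> \<le> q" for q using that by (simp add: field_simps)
  from this[OF 1(2)] show "\<kappa>\<^sup>2 / real N \<le> 1 / 2" unfolding k by simp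
qed

text \<open>Up to the time \<open>start g\<close> the solution still feels only its initial value, and this alone
  dissipates an amount of energy that does not depend on \<open>g\<close>.\<close>

lemma emden_energy_start:
  obtains c where "c > 0" "\<And>g u. g > 1 \<Longrightarrow> radial_sol N p g u \<Longrightarrow>
    energy (emden u) (emden' u) (start g) \<le> - c \<and> emden u (start g) > 0"
proof -
  \<comment> \<open>A lower bound for \<open>emden'\<close> on the unit interval before
    \<open>start g\<close>: there the weight is at least
    \<open>\<kappa> powr \<theta> * exp (- m * \<theta>) / g\<close>, and its \<open>1 / g\<close>
    cancels the factor in \<open>g * (\<theta> / 2)\<close>.\<close>
  define d where "d = m * \<kappa> powr \<theta> * exp (- m * \<theta>) * (\<theta> / 2) / A"
  have d: "d > 0" using m_pos kappa(1) theta_pos A_pos by (simp add: d_def)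
  show ?thesis
  proof (rule that[of "\<alpha> * d\<^sup>2"])
    show "\<alpha> * d\<^sup>2 > 0" using alpha_pos d by simp
    fix g u assume g: "g > 1" and u: "radial_sol N p g u"
    \<comment> \<open>Such times satisfy
      \<open>s\<^sup>2 \<le> \<kappa>\<^sup>2 * g powr (1 - p)\<close>, which makes the error in
      \<open>radial_sol_lower_bounds\<close> at most
      \<open>g * (\<kappa>\<^sup>2 / N)\<close>.\<close>
    have low: "u s \<ge> g / 2 \<and> \<theta> * u s + s * deriv u s \<ge> g * (\<theta> / 2)" if t: "t \<le> start g" "s = exp (m * t)" for t s
    proof -
      have s: "s > 0" using t by simp
      have "m * t \<le> m * start g" using t m_pos by simp
      also have "\<dots> = ln \<kappa> - (p - 1) / 2 * ln g" using m_pos by (simp add: start_def)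
      finally have "m * t \<le> ln \<kappa> - (p - 1) / 2 * ln g" .
      moreover have "2 * ((p - 1) / 2 * ln g) = - ((1 - p) * ln g)" by (simp add: field_simps)
      ultimately have "2 * (m * t) \<le> 2 * ln \<kappa> + (1 - p) * ln g" by linarith
      then have "exp (2 * (m * t)) \<le> exp (2 * ln \<kappa> + (1 - p) * ln g)" by simp
      also have "\<dots> = \<kappa>\<^sup>2 * g powr (1 - p)"
        using kappa(1) g by (simp add: exp_add powr_def exp_double)
      also have "exp (2 * (m * t)) = s\<^sup>2" by (simp add: t exp_double)
      finally have "g powr p * s\<^sup>2 \<le> g powr p * (\<kappa>\<^sup>2 * g powr (1 - p))" by (intro mult_left_mono) auto
      also have "\<dots> = \<kappa>\<^sup>2 * (g powr p * g powr (1 - p))" by simp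
      also have "g powr p * g powr (1 - p) = g" using g by (simp flip: powr_add)
      finally have "g powr p * s\<^sup>2 / real N \<le> \<kappa>\<^sup>2 * g / real N" by (intro divide_right_mono) auto
      then have b: "g powr p * s\<^sup>2 / real N \<le> g * (\<kappa>\<^sup>2 / real N)" by (simp add: mult.commute)
      have us: "u s \<ge> g - g * (\<kappa>\<^sup>2 / real N)" using radial_sol_lower_bounds(2)[OF u g s] b by linarith
      have "s * deriv u s \<ge> s * - (g powr p * s / real N)"
        using radial_sol_lower_bounds(1)[OF u g s] s by (intro mult_left_mono) auto
      then have ds: "s * deriv u s \<ge> - (g * (\<kappa>\<^sup>2 / real N))" using b by (simp add: power2_eq_square algebra_simps)
      have "g * (\<kappa>\<^sup>2 / real N) \<le> g * (1 / 2)" using kappa(3) g by (intro mult_left_mono) auto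
      moreover have "\<theta> * u s \<ge> \<theta> * (g - g * (\<kappa>\<^sup>2 / real N))" using us theta_pos by (intro mult_left_mono) auto
      moreover have "\<theta> * (g - g * (\<kappa>\<^sup>2 / real N)) - g * (\<kappa>\<^sup>2 / real N) = g * (\<theta> - \<kappa>\<^sup>2 / real N * (\<theta> + 1))"
        by (simp add: algebra_simps add_divide_distrib)
      moreover have "g * (\<theta> - \<kappa>\<^sup>2 / real N * (\<theta> + 1)) = g * (\<theta> / 2)"
        unfolding kappa(2) by simp
      ultimately show ?thesis using us ds by linarith
    qed
    have vlow: "emden' u t \<ge> d" if t: "start g - 1 \<le> t" "t \<le> start g" for t
    proof -
      have "m * \<theta> * start g = \<theta> * ln \<kappa> - (\<theta> * (p - 1)) / 2 * ln g" using m_pos by (simp add: start_def field_simps)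
      also have "\<dots> = \<theta> * ln \<kappa> - ln g" unfolding theta_p by simp
      finally have "\<theta> * ln \<kappa> - ln g - m * \<theta> = m * \<theta> * (start g - 1)" by (simp add: algebra_simps)
      also have "\<dots> \<le> m * \<theta> * t" using t m_pos theta_pos by (intro mult_left_mono) auto
      finally have "exp (\<theta> * ln \<kappa> - ln g - m * \<theta>) \<le> exp (m * \<theta> * t)" by simp
      moreover have "exp (\<theta> * ln \<kappa> - ln g - m * \<theta>) = \<kappa> powr \<theta> * exp (- m * \<theta>) / g"
        using kappa(1) g by (simp add: powr_def exp_diff exp_minus divide_inverse mult_ac)
      ultimately have "\<kappa> powr \<theta> * exp (- m * \<theta>) / g \<le> exp (m * \<theta> * t)" by simp
      then have "(m * (\<kappa> powr \<theta> * exp (- m * \<theta>) / g)) * (g * (\<theta> / 2)) \<le>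
          (m * exp (m * \<theta> * t)) * (\<theta> * u (exp (m * t)) + exp (m * t) * deriv u (exp (m * t)))"
        using low[OF t(2) refl] m_pos g theta_pos by (intro mult_mono mult_left_mono) auto
      also have "(m * (\<kappa> powr \<theta> * exp (- m * \<theta>) / g)) * (g * (\<theta> / 2)) = d * A"
        using g A_pos by (simp add: d_def)
      finally show ?thesis using A_pos by (simp add: emden'_def pos_le_divide_eq)
    qed
    \<comment> \<open>On an interval of length 1 the mean value theorem turns the dissipation rate
      \<open>\<alpha> * d\<^sup>2\<close> directly into an energy loss.\<close>
    obtain z where z: "start g - 1 < z" "z < start g"
      "energy (emden u) (emden' u) (start g) - energy (emden u) (emden' u) (start g - 1)
        = (start g - (start g - 1)) * (- \<alpha> * (emden' u z)\<^sup>2 - m^3 * exp (2 * m * z) * (emden u z)\<^sup>2)"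
      using MVT2[of "start g - 1" "start g" "energy (emden u) (emden' u)"
          "\<lambda>z. - \<alpha> * (emden' u z)\<^sup>2 - m^3 * exp (2 * m * z) * (emden u z)\<^sup>2"]
        energy_deriv[OF emden_sol[OF u]] by auto
    have "d\<^sup>2 \<le> (emden' u z)\<^sup>2" using vlow[of z] z d by (intro power_mono) auto
    then have "\<alpha> * d\<^sup>2 \<le> \<alpha> * (emden' u z)\<^sup>2" using alpha_pos by (intro mult_left_mono) auto
    moreover have "m^3 * exp (2 * m * z) * (emden u z)\<^sup>2 \<ge> 0" using m_pos by auto
    moreover have "energy (emden u) (emden' u) (start g - 1) \<le> 0" by (rule emden_energy_nonpos[OF u])
    ultimately have "energy (emden u) (emden' u) (start g) \<le> - (\<alpha> * d\<^sup>2)" using z(3) by simp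
    moreover have "u (exp (m * start g)) > 0" using low[OF order_refl refl] g by linarith
    then have "emden u (start g) > 0" using A_pos by (simp add: emden_def)
    ultimately show "energy (emden u) (emden' u) (start g) \<le> - (\<alpha> * d\<^sup>2) \<and> emden u (start g) > 0" by simp
  qed
qed

lemma start_tendsto:
  assumes "filterlim \<gamma> at_top sequentially"
  shows "filterlim (\<lambda>j. start (\<gamma> j)) at_bot sequentially"
proof -
  have "filterlim (\<lambda>j. (p - 1) / 2 / m * ln (\<gamma> j)) at_top sequentially"
    using p_gt_1 m_pos
    by (intro filterlim_tendsto_pos_mult_at_top[OF tendsto_const] filterlim_compose[OF ln_at_top assms]) auto
  then have "filterlim (\<lambda>j. - ln \<kappa> / m + (p - 1) / 2 / m * ln (\<gamma> j)) at_top sequentially"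
    by (rule filterlim_tendsto_add_at_top[OF tendsto_const])
  then have "filterlim (\<lambda>j. - (- ln \<kappa> / m + (p - 1) / 2 / m * ln (\<gamma> j))) at_bot sequentially"
    by (simp add: filterlim_uminus_at_bot)
  moreover have "(ln \<kappa> - q * l) / m = - (- ln \<kappa> / m + q / m * l)" for q l
    by (simp add: diff_divide_distrib)
  then have "start (\<gamma> j) = - (- ln \<kappa> / m + (p - 1) / 2 / m * ln (\<gamma> j))" for j
    unfolding start_def by blast
  ultimately show ?thesis by simp
qed

end

section \<open>Return from the phase plane to the radial solutions\<close>

theorem theorem5p1:
  fixes N :: nat and p S :: real and y :: "real \<Rightarrow> real"
    and \<gamma> :: "nat \<Rightarrow> real" and u :: "nat \<Rightarrow> real \<Rightarrow> real"
  assumes "N \<ge> 3" and "p > pS N" and "S > 0"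
    and "ystar_sol N p y"
    and "filterlim \<gamma> at_top sequentially"
    and "\<And>j. radial_sol N p (\<gamma> j) (u j)"
  shows "\<forall>K. compact K \<and> K \<subseteq> {0<..S} \<longrightarrow>
           uniform_limit K (\<lambda>j. u j) (ustar_of N p y) sequentially \<and>
           uniform_limit K (\<lambda>j. deriv (u j)) (deriv (ustar_of N p y)) sequentially \<and>
           uniform_limit K (\<lambda>j. deriv (deriv (u j))) (deriv (deriv (ustar_of N p y))) sequentially"
proof (intro allI impI)
  fix K assume K: "compact K \<and> K \<subseteq> {0<..S}"
  interpret supercritical N p using assms(1,2) by unfold_locales
  have y: "sol y (deriv y)"
    unfolding sol_def
  proof (intro allI conjI)
    fix t
    have *: "y differentiable (at t)" "deriv y differentiable (at t)"
      "deriv (deriv y) t + \<alpha> * deriv y t - y t + spow p (y t) - m\<^sup>2 * exp (2 * m * t) * y t = 0"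
      using assms(4) unfolding ystar_sol_def by auto
    show "(y has_real_derivative deriv y t) (at t)"
      using *(1) by (simp add: DERIV_deriv_iff_real_differentiable)
    have "(deriv y has_real_derivative deriv (deriv y) t) (at t)"
      using *(2) by (simp add: DERIV_deriv_iff_real_differentiable)
    then show "(deriv y has_real_derivative - \<alpha> * deriv y t + (1 + m\<^sup>2 * exp (2 * m * t)) * y t - spow p (y t)) (at t)"
      by (rule DERIV_cong) (use *(3) in \<open>simp add: algebra_simps\<close>)
  qed
  have y1: "(y \<longlongrightarrow> 1) at_bot" using assms(4) unfolding ystar_sol_def by simp
  obtain c where c: "c > 0" "\<And>g u. g > 1 \<Longrightarrow> radial_sol N p g u \<Longrightarrow>
    energy (emden u) (emden' u) (start g) \<le> - c \<and> emden u (start g) > 0"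
    using emden_energy_start by metis
  have "\<forall>\<^sub>F j in sequentially. \<gamma> j > 1" using assms(5) by (simp add: filterlim_at_top_dense)
  then have ev: "\<forall>\<^sub>F j in sequentially. sol (emden (u j)) (emden' (u j))
      \<and> (\<forall>t. energy (emden (u j)) (emden' (u j)) t \<le> 0)
      \<and> energy (emden (u j)) (emden' (u j)) (start (\<gamma> j)) \<le> - c \<and> emden (u j) (start (\<gamma> j)) > 0"
    by eventually_elim (use c(2) emden_sol emden_energy_nonpos assms(6) in blast)
  have conv: "\<forall>\<^sub>F j in sequentially. \<forall>t\<in>{T1..T2}.
      \<bar>emden (u j) t - y t\<bar> < e \<and> \<bar>emden' (u j) t - deriv y t\<bar> < e" if "e > 0" for T1 T2 e
    by (rule locally_uniform_convergence[OF y y1 c(1) that start_tendsto[OF assms(5)] ev])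
  have sols: "sol (emden (u j)) (emden' (u j))" for j using emden_sol assms(6) by blast
  have Kpos: "K \<subseteq> {0<..}" "\<And>s. s \<in> K \<Longrightarrow> s > 0" using K by auto
  note lims = uniform_limits_of_phase_space[OF y sols conv _ Kpos(1)]
  \<comment> \<open>The identity holds for \<open>s > 0\<close> only; as this set is open it passes
    to both derivatives, and \<open>K\<close> lies inside it.\<close>
  have u0: "u j s = ustar_of N p (emden (u j)) s" if "s > 0" for j s
    using ustar_emden[OF that] by simp
  have u1: "deriv (u j) s = ustar1 (emden (u j)) (emden' (u j)) s" if "s > 0" for j s
    using deriv_cong_open[of "{0<..}" s "u j" "ustar_of N p (emden (u j))"] u0 that
      ustar_deriv_eq(1)[OF sols] by simp
  have u2: "deriv (deriv (u j)) s = ustar2 (emden (u j)) (emden' (u j)) s" if "s > 0" for j s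
    using deriv_cong_open[of "{0<..}" s "deriv (u j)" "ustar1 (emden (u j)) (emden' (u j))"] u1 that
      DERIV_imp_deriv[OF ustar_derivs(2)[OF sols that]] by simp
  show "uniform_limit K (\<lambda>j. u j) (ustar_of N p y) sequentially \<and>
     uniform_limit K (\<lambda>j. deriv (u j)) (deriv (ustar_of N p y)) sequentially \<and>
     uniform_limit K (\<lambda>j. deriv (deriv (u j))) (deriv (deriv (ustar_of N p y))) sequentially"
  proof (intro conjI)
    show "uniform_limit K (\<lambda>j. u j) (ustar_of N p y) sequentially"
      by (rule uniform_limit_cong'[THEN iffD2, OF _ _ lims(1)]) (use u0 K Kpos in auto)
    show "uniform_limit K (\<lambda>j. deriv (u j)) (deriv (ustar_of N p y)) sequentially"
      by (rule uniform_limit_cong'[THEN iffD2, OF _ _ lims(2)])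
        (use u1 ustar_deriv_eq(1)[OF y] K Kpos in auto)
    show "uniform_limit K (\<lambda>j. deriv (deriv (u j))) (deriv (deriv (ustar_of N p y))) sequentially"
      by (rule uniform_limit_cong'[THEN iffD2, OF _ _ lims(3)])
        (use u2 ustar_deriv_eq(2)[OF y] K Kpos in auto)
  qed
qed

end
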